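(* Let $u:\mathbb{R}^n\times[0,\infty)\to\mathbb{R}$ be a (continuous, bounded) viscosity solution, in the sense of Evans–Spruck defined below, of the level set mean curvature flow $$u_t=\Big(\delta_{ij}-\frac{D_iuD_ju}{|Du|^2}\Big)D_iD_ju,$$ with initial data $u(\cdot,0)=g$, where $g:\mathbb{R}^n\to\mathbb{R}$ is continuous and constant on $\{x\in\mathbb{R}^n:|x|\ge S\}$ for some $S>0$. Define $$\omega(s,t)=\sup\Big\{\tfrac{u(y,t)-u(x,t)}{2}\;:\;x,y\in\mathbb{R}^n,\ \tfrac{|y-x|}{2}=s\Big\}.$$ Then $\omega$ is a viscosity subsolution of $\omega_t=\max\{0,\tfrac14(\omega''+|\omega''|)\}$ on $(0,\infty)\times(0,\infty)$; that is, whenever $\phi$ is a smooth function such that $\omega-\phi$ has a local maximum at $(s_0,t_0)$ with $s_0>0$, $t_0>0$, then at $(s_0,t_0)$ $$\phi_t\le \max\Big\{0,\tfrac14\big(\phi''+|\phi''|\big)\Big\},$$ where $'$ denotes differentiation in $s$.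
   Context: Evans–Spruck viscosity solutions of the level set mean curvature flow: a continuous bounded $u:\mathbb{R}^n\times[0,\infty)\to\mathbb{R}$ is a viscosity subsolution if for every $\varphi\in C^\infty(\mathbb{R}^{n+1})$ such that $u-\varphi$ has a local maximum at $(x_0,t_0)\in\mathbb{R}^n\times(0,\infty)$: if $D\varphi(x_0,t_0)\neq0$ then $\varphi_t\le(\delta_{ij}-\frac{D_i\varphi D_j\varphi}{|D\varphi|^2})D_iD_j\varphi$ at $(x_0,t_0)$, and if $D\varphi(x_0,t_0)=0$ then $\varphi_t\le(\delta_{ij}-\eta_i\eta_j)D_iD_j\varphi$ at $(x_0,t_0)$ for some $\eta\in\mathbb{R}^n$ with $|\eta|\le1$. It is a viscosity supersolution if the same holds with "local minimum" and "$\ge$" in place of "local maximum" and "$\le$". A viscosity solution is a continuous bounded function that is both. Summation over repeated indices is used. *)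

theory Defs
  imports "HOL-Analysis.Analysis"
begin

definition dirD :: "'a::real_normed_vector \<Rightarrow> ('a \<Rightarrow> real) \<Rightarrow> ('a \<Rightarrow> real)" where
  "dirD v f = (\<lambda>x. frechet_derivative f (at x) v)"

fun iterD :: "'a::real_normed_vector list \<Rightarrow> ('a \<Rightarrow> real) \<Rightarrow> ('a \<Rightarrow> real)" where
  "iterD [] f = f"
| "iterD (v # vs) f = dirD v (iterD vs f)"

definition smooth :: "('a::real_normed_vector \<Rightarrow> real) \<Rightarrow> bool" where
  "smooth f \<longleftrightarrow> (\<forall>vs x. iterD vs f differentiable (at x))"

definition Dx :: "'n::finite \<Rightarrow> ((real^'n) \<times> real \<Rightarrow> real) \<Rightarrow> ((real^'n) \<times> real \<Rightarrow> real)" where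
  "Dx i f = dirD (axis i 1, 0) f"

definition Dt :: "('a::real_normed_vector \<times> real \<Rightarrow> real) \<Rightarrow> ('a \<times> real \<Rightarrow> real)" where
  "Dt f = dirD (0, 1) f"

definition grad_x :: "((real^'n::finite) \<times> real \<Rightarrow> real) \<Rightarrow> (real^'n) \<times> real \<Rightarrow> real^'n" where
  "grad_x f p = (\<chi> i. Dx i f p)"

definition delta :: "'n \<Rightarrow> 'n \<Rightarrow> real" where
  "delta i j = (if i = j then 1 else 0)"

text \<open>Evans--Spruck viscosity sub/supersolutions of level set mean curvature flow.
  u is given as a function of (x,t); only t >= 0 is relevant.\<close>
definition local_max_at :: "((real^'n::finite) \<times> real \<Rightarrow> real) \<Rightarrow> (real^'n) \<times> real \<Rightarrow> bool" where
  "local_max_at w p0 \<longleftrightarrow> (\<exists>e>0. \<forall>p. snd p \<ge> 0 \<longrightarrow> dist p p0 < e \<longrightarrow> w p \<le> w p0)"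

definition local_min_at :: "((real^'n::finite) \<times> real \<Rightarrow> real) \<Rightarrow> (real^'n) \<times> real \<Rightarrow> bool" where
  "local_min_at w p0 \<longleftrightarrow> (\<exists>e>0. \<forall>p. snd p \<ge> 0 \<longrightarrow> dist p p0 < e \<longrightarrow> w p \<ge> w p0)"

definition mcf_op :: "real^'n::finite \<Rightarrow> ((real^'n) \<times> real \<Rightarrow> real) \<Rightarrow> (real^'n) \<times> real \<Rightarrow> real" where
  "mcf_op \<eta> \<phi> p = (\<Sum>i\<in>UNIV. \<Sum>j\<in>UNIV. (delta i j - \<eta> $ i * \<eta> $ j) * Dx i (Dx j \<phi>) p)"

definition cont_bdd :: "((real^'n::finite) \<Rightarrow> real \<Rightarrow> real) \<Rightarrow> bool" where
  "cont_bdd u \<longleftrightarrow> continuous_on (UNIV \<times> {0..}) (\<lambda>(x,t). u x t) \<and>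
     bounded ((\<lambda>(x,t). u x t) ` (UNIV \<times> {0..}))"

definition mcf_visc_sub :: "((real^'n::finite) \<Rightarrow> real \<Rightarrow> real) \<Rightarrow> bool" where
  "mcf_visc_sub u \<longleftrightarrow> cont_bdd u \<and>
    (\<forall>\<phi> x0 t0. smooth \<phi> \<and> t0 > 0 \<and> local_max_at (\<lambda>(x,t). u x t - \<phi> (x,t)) (x0,t0) \<longrightarrow>
       (grad_x \<phi> (x0,t0) \<noteq> 0 \<longrightarrow>
          Dt \<phi> (x0,t0) \<le> mcf_op (grad_x \<phi> (x0,t0) /\<^sub>R norm (grad_x \<phi> (x0,t0))) \<phi> (x0,t0)) \<and>
       (grad_x \<phi> (x0,t0) = 0 \<longrightarrow>
          (\<exists>\<eta>. norm \<eta> \<le> 1 \<and> Dt \<phi> (x0,t0) \<le> mcf_op \<eta> \<phi> (x0,t0))))"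

definition mcf_visc_super :: "((real^'n::finite) \<Rightarrow> real \<Rightarrow> real) \<Rightarrow> bool" where
  "mcf_visc_super u \<longleftrightarrow> cont_bdd u \<and>
    (\<forall>\<phi> x0 t0. smooth \<phi> \<and> t0 > 0 \<and> local_min_at (\<lambda>(x,t). u x t - \<phi> (x,t)) (x0,t0) \<longrightarrow>
       (grad_x \<phi> (x0,t0) \<noteq> 0 \<longrightarrow>
          Dt \<phi> (x0,t0) \<ge> mcf_op (grad_x \<phi> (x0,t0) /\<^sub>R norm (grad_x \<phi> (x0,t0))) \<phi> (x0,t0)) \<and>
       (grad_x \<phi> (x0,t0) = 0 \<longrightarrow>
          (\<exists>\<eta>. norm \<eta> \<le> 1 \<and> Dt \<phi> (x0,t0) \<ge> mcf_op \<eta> \<phi> (x0,t0))))"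

definition mcf_visc_sol :: "((real^'n::finite) \<Rightarrow> real \<Rightarrow> real) \<Rightarrow> bool" where
  "mcf_visc_sol u \<longleftrightarrow> mcf_visc_sub u \<and> mcf_visc_super u"

definition modulus :: "((real^'n::finite) \<Rightarrow> real \<Rightarrow> real) \<Rightarrow> real \<Rightarrow> real \<Rightarrow> real" where
  "modulus u s t = Sup {(u y t - u x t) / 2 | x y. norm (y - x) / 2 = s}"

end

theory Submission
  imports Defs
begin

text \<open>
  The modulus is nonincreasing in time: for each fixed shift \<open>z\<close> the comparison principle,
  applied to the solution \<open>u\<close> and its translate by \<open>z\<close>, shows that
  \<open>sup\<^sub>x (u (x + z) t - u x t)\<close> is nonincreasing in \<open>t\<close>. A function touching \<open>\<omega>\<close> from above
  therefore has \<open>\<phi>\<^sub>t \<le> 0\<close>, which is stronger than the claim.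

  Comparison is proved by doubling variables after a sup-convolution in space, with the penalty
  \<open>N |x - y - z|\<^sup>4\<close>. If the maximum has \<open>x = y + z\<close>, gradient and Hessian of the penalty vanish
  and the viscosity inequalities contradict each other directly. Otherwise the gradients of all
  test functions at nearby points are close to a fixed nonzero vector, and since their Hessians are
  bounded below, both functions are viscosity subsolutions of one linear equation with constant
  coefficients, up to a small error. Such a subsolution lies below every exact
  solution that dominates it initially, so each function is compared with an explicit
  trigonometric sum that approximates it at an earlier time. The sum of the two approximants,
  translated simultaneously, solves the same linear equation, and the classical maximum principle
  gives the contradiction. This linear comparison takes the place of the theorem on sums.
\<close>

subsection \<open>Calculus of smooth functions\<close>

text \<open>The obstacle is that a test function comes with no bound on its Hessian, so replacing
  its normal direction by a fixed nearby one could cost an unbounded error. Sup-convolution supplies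
  a lower Hessian bound, and that suffices: the error is then a small multiple of the trace of a
  nonnegative form, that is of the Laplacian plus a constant, and the multiple of the Laplacian is
  put into the linear equation.

  The contradiction comes from the term \<open>l * t\<close> of the penalty. Translating both points
  by the same vector and moving both times back by \<tau> leaves the rest of the penalty unchanged
  and gains \<open>l * \<tau>\<close>, so all errors together must stay below this. That is why the
  localising barrier \<open>bar2\<close> is a square: at the centre it is only of order \<tau>^2,
  while on the boundary of a fixed cylinder it stays above a fixed constant. A barrier linear in
  time would itself cost a multiple of \<tau> with a large coefficient.\<close>

lemma smooth_differentiable: "smooth f \<Longrightarrow> f differentiable (at x)"
  unfolding smooth_def by (metis iterD.simps(1))

lemma iterD_append: "iterD (vs @ ws) f = iterD vs (iterD ws f)"
  by (induction vs) auto

lemma smooth_dirD: "smooth f \<Longrightarrow> smooth (dirD v f)"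
  unfolding smooth_def by (metis iterD.simps iterD_append)

text \<open>Derivatives along arbitrary lists of directions are awkward to compute. It is enough to
  exhibit a family of differentiable functions that contains \<open>f\<close> and is invariant under
  \<open>dirD\<close>.\<close>

lemma smooth_coinduct:
  assumes "f \<in> F"
    and diff: "\<And>g x. g \<in> F \<Longrightarrow> g differentiable (at x)"
    and step: "\<And>g v. g \<in> F \<Longrightarrow> dirD v g \<in> F"
  shows "smooth f"
proof -
  have "iterD vs f \<in> F" for vs
    using assms(1) step by (induction vs) auto
  then show ?thesis
    unfolding smooth_def using diff by blast
qed

lemma dirD_eqI: "(f has_derivative f') (at x) \<Longrightarrow> dirD v f x = f' v"
  unfolding dirD_def using frechet_derivative_at by metis

lemma has_derivative_dirD:
  "f differentiable (at x) \<Longrightarrow> (f has_derivative (\<lambda>v. dirD v f x)) (at x)"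
  unfolding dirD_def by (simp add: frechet_derivative_works)

lemma linear_dirD: "f differentiable (at x) \<Longrightarrow> linear (\<lambda>v. dirD v f x)"
  using has_derivative_dirD has_derivative_linear by blast

lemma dirD_add:
  assumes "smooth f" "smooth g"
  shows "dirD v (\<lambda>x. f x + g x) = (\<lambda>x. dirD v f x + dirD v g x)"
  by (rule ext, rule dirD_eqI, rule has_derivative_add)
     (intro has_derivative_dirD smooth_differentiable assms)+

lemma dirD_mult':
  assumes "f differentiable (at x)" "g differentiable (at x)"
  shows "dirD v (\<lambda>x. f x * g x) x = f x * dirD v g x + dirD v f x * g x"
  by (rule dirD_eqI, rule has_derivative_mult) (intro has_derivative_dirD assms)+

lemma dirD_mult:
  assumes "smooth f" "smooth g"
  shows "dirD v (\<lambda>x. f x * g x) = (\<lambda>x. f x * dirD v g x + dirD v f x * g x)"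
  using assms by (auto intro!: ext dirD_mult' smooth_differentiable)

text \<open>By the product rule the derivative of a product is a sum of products, so products alone
  are not invariant under \<open>dirD\<close>. The generated algebra is, and can be fed to
  \<open>smooth_coinduct\<close>.\<close>

inductive_set smooth_alg :: "('a::real_normed_vector \<Rightarrow> real) set" where
  base: "smooth f \<Longrightarrow> f \<in> smooth_alg"
| add: "f \<in> smooth_alg \<Longrightarrow> g \<in> smooth_alg \<Longrightarrow> (\<lambda>x. f x + g x) \<in> smooth_alg"
| mult: "f \<in> smooth_alg \<Longrightarrow> g \<in> smooth_alg \<Longrightarrow> (\<lambda>x. f x * g x) \<in> smooth_alg"

lemma smooth_alg_differentiable: "f \<in> smooth_alg \<Longrightarrow> f differentiable (at x)"
  by (induction rule: smooth_alg.induct) (auto intro: smooth_differentiable)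

lemma smooth_alg_dirD: "f \<in> smooth_alg \<Longrightarrow> dirD v f \<in> smooth_alg"
proof (induction rule: smooth_alg.induct)
  case (base f)
  then show ?case by (simp add: smooth_alg.base smooth_dirD)
next
  case (add f g)
  have "dirD v (\<lambda>x. f x + g x) = (\<lambda>x. dirD v f x + dirD v g x)"
    by (rule ext, rule dirD_eqI, rule has_derivative_add)
       (intro has_derivative_dirD smooth_alg_differentiable add)+
  then show ?case using add by (simp add: smooth_alg.add)
next
  case (mult f g)
  have "dirD v (\<lambda>x. f x * g x) = (\<lambda>x. f x * dirD v g x + dirD v f x * g x)"
    using mult by (auto intro!: ext dirD_mult' smooth_alg_differentiable)
  then show ?case using mult by (simp add: smooth_alg.add smooth_alg.mult)
qed

lemma smooth_alg_smooth: "f \<in> smooth_alg \<Longrightarrow> smooth f"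
  by (rule smooth_coinduct[of f smooth_alg])
     (auto intro: smooth_alg_differentiable smooth_alg_dirD)

lemma smooth_add: "smooth f \<Longrightarrow> smooth g \<Longrightarrow> smooth (\<lambda>x. f x + g x)"
  by (simp add: smooth_alg.add smooth_alg.base smooth_alg_smooth)

lemma smooth_mult: "smooth f \<Longrightarrow> smooth g \<Longrightarrow> smooth (\<lambda>x. f x * g x)"
  by (simp add: smooth_alg.mult smooth_alg.base smooth_alg_smooth)

lemma dirD_const: "dirD v (\<lambda>x. c) = (\<lambda>x. 0)"
  by (rule ext, rule dirD_eqI) (rule has_derivative_const)

lemma smooth_const: "smooth (\<lambda>x. c)"
  by (rule smooth_coinduct[of _ "range (\<lambda>c x. c)"]) (auto simp: dirD_const)

lemma dirD_cmult: "smooth f \<Longrightarrow> dirD v (\<lambda>x. c * f x) = (\<lambda>x. c * dirD v f x)"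
  by (simp add: dirD_mult smooth_const dirD_const)

lemma smooth_cmult: "smooth f \<Longrightarrow> smooth (\<lambda>x. c * f x)"
  by (intro smooth_mult smooth_const)

lemma smooth_minus: "smooth f \<Longrightarrow> smooth (\<lambda>x. - f x)"
  using smooth_cmult[of f "-1"] by simp

lemma dirD_minus: "smooth f \<Longrightarrow> dirD v (\<lambda>x. - f x) = (\<lambda>x. - dirD v f x)"
  using dirD_cmult[of f v "-1"] by simp

lemma smooth_sum: "(\<And>i. i \<in> I \<Longrightarrow> smooth (f i)) \<Longrightarrow> smooth (\<lambda>x. \<Sum>i\<in>I. f i x)"
  by (induction I rule: infinite_finite_induct) (auto intro: smooth_const smooth_add)

lemma dirD_sum:
  "(\<And>i. i \<in> I \<Longrightarrow> smooth (f i)) \<Longrightarrow> dirD v (\<lambda>x. \<Sum>i\<in>I. f i x) = (\<lambda>x. \<Sum>i\<in>I. dirD v (f i) x)"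
  by (induction I rule: infinite_finite_induct) (auto simp: dirD_const dirD_add smooth_sum)

lemma dirD_affine:
  assumes "bounded_linear l"
  shows "dirD v (\<lambda>x. l x + c) = (\<lambda>x. l v)"
  by (rule ext, rule dirD_eqI)
     (use assms in \<open>auto intro!: derivative_eq_intros bounded_linear.has_derivative[of l]\<close>)

lemma smooth_affine:
  assumes "bounded_linear l"
  shows "smooth (\<lambda>x. l x + c)"
  by (rule smooth_coinduct[of _ "insert (\<lambda>x. l x + c) (range (\<lambda>c x. c))"])
     (use assms in \<open>auto simp: dirD_affine dirD_const bounded_linear_imp_differentiable
        intro!: differentiable_add\<close>)

lemma has_derivative_shift:
  assumes "(f has_derivative f') (at (x + a))"
  shows "((\<lambda>x. f (x + a)) has_derivative f') (at x)"
proof -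
  have "((\<lambda>x. x + a) has_derivative (\<lambda>v. v)) (at x)"
    by (auto intro!: derivative_eq_intros)
  from diff_chain_at[OF this assms] show ?thesis by (simp add: o_def)
qed

lemma dirD_shift:
  assumes "smooth f"
  shows "dirD v (\<lambda>x. f (x + a)) = (\<lambda>x. dirD v f (x + a))"
  by (rule ext, rule dirD_eqI, rule has_derivative_shift)
     (intro has_derivative_dirD smooth_differentiable assms)

lemma smooth_shift:
  assumes "smooth f"
  shows "smooth (\<lambda>x. f (x + a))"
proof (rule smooth_coinduct[of _ "{(\<lambda>x. g (x + a)) | g. smooth g}"])
  show "(\<lambda>x. f (x + a)) \<in> {(\<lambda>x. g (x + a)) | g. smooth g}" using assms by blast
next
  fix h x assume "h \<in> {(\<lambda>x. g (x + a)) | g. smooth g}"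
  then show "h differentiable (at x)"
    by (auto simp: differentiable_def)
       (metis has_derivative_shift has_derivative_dirD smooth_differentiable)
next
  fix h v assume "h \<in> {(\<lambda>x. g (x + a)) | g. smooth g}"
  then show "dirD v h \<in> {(\<lambda>x. g (x + a)) | g. smooth g}"
    by (auto simp: dirD_shift) (metis smooth_dirD)
qed

lemma has_real_derivative_line:
  assumes "smooth f"
  shows "((\<lambda>s. f (p + s *\<^sub>R v)) has_real_derivative dirD v f (p + s *\<^sub>R v)) (at s)"
proof -
  let ?q = "p + s *\<^sub>R v"
  have d: "f differentiable (at ?q)" using assms by (rule smooth_differentiable)
  have "((\<lambda>s. p + s *\<^sub>R v) has_derivative (\<lambda>h. h *\<^sub>R v)) (at s)"
    by (auto intro!: derivative_eq_intros)
  from diff_chain_at[OF this has_derivative_dirD[OF d]]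
  have "((\<lambda>s. f (p + s *\<^sub>R v)) has_derivative (\<lambda>h. dirD (h *\<^sub>R v) f ?q)) (at s)"
    by (simp add: o_def)
  moreover have "(\<lambda>h. dirD (h *\<^sub>R v) f ?q) = (*) (dirD v f ?q)"
    using linear_scale[OF linear_dirD[OF d]] by (auto simp: mult.commute)
  ultimately show ?thesis unfolding has_field_derivative_def by simp
qed

text \<open>Subtracting the parabola leaves a function with a local minimum at \<open>0\<close>,
  which gives the first claim. If its second derivative there were negative, its first derivative
  would be negative just to the right, and the mean value theorem would yield a smaller
  value.\<close>

lemma second_order_lower:
  fixes f f' :: "real \<Rightarrow> real"
  assumes f': "\<And>s. (f has_real_derivative f' s) (at s)"
    and f'': "(f' has_real_derivative c) (at 0)"
    and "d > 0" and low: "\<And>s. \<bar>s\<bar> < d \<Longrightarrow> f s \<ge> f 0 + a * s - m * s\<^sup>2"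
  shows "f' 0 = a" "c \<ge> - 2 * m"
proof -
  define g where "g s = f s - a * s + m * s\<^sup>2" for s
  define g' where "g' s = f' s - a + 2 * m * s" for s
  have g1: "(g has_real_derivative g' s) (at s)" for s
    unfolding g_def g'_def
    by (rule derivative_eq_intros f' refl)+ (simp add: algebra_simps)
  have g2: "(g' has_real_derivative c + 2 * m) (at 0)"
    unfolding g'_def by (rule derivative_eq_intros f'' refl)+ simp
  have gmin: "g 0 \<le> g s" if "\<bar>s\<bar> < d" for s
    using low[OF that] by (simp add: g_def)
  have g0: "g' 0 = 0"
    by (rule DERIV_local_min[OF g1 \<open>d > 0\<close>]) (use gmin in auto)
  then show "f' 0 = a" by (simp add: g'_def)
  show "c \<ge> - 2 * m"
  proof (rule ccontr)
    assume "\<not> ?thesis"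
    then have "c + 2 * m < 0" by simp
    from DERIV_neg_dec_right[OF g2 this] obtain e where
      e: "e > 0" "\<And>h. h > 0 \<Longrightarrow> h < e \<Longrightarrow> g' (0 + h) < g' 0" by auto
    define s where "s = min e d / 2"
    have s: "0 < s" "s < e" "s < d" using e \<open>d > 0\<close> by (auto simp: s_def)
    obtain z where z: "0 < z" "z < s" "g s - g 0 = (s - 0) * g' z"
      using MVT2[OF s(1), of g g'] g1 by blast
    have "g' z < 0" using e(2)[of z] z s g0 by auto
    then have "g s < g 0" using z s by (simp add: mult_pos_neg algebra_simps)
    with gmin[of s] s show False by auto
  qed
qed

subsection \<open>Second derivatives in space\<close>

definition D2 :: "real^'n::finite \<Rightarrow> real^'n \<Rightarrow> ((real^'n) \<times> real \<Rightarrow> real) \<Rightarrow> (real^'n) \<times> real \<Rightarrow> real" where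
  "D2 v w f p = dirD (v, 0) (dirD (w, 0) f) p"

definition Lap :: "((real^'n::finite) \<times> real \<Rightarrow> real) \<Rightarrow> (real^'n) \<times> real \<Rightarrow> real" where
  "Lap f p = (\<Sum>i\<in>UNIV. D2 (axis i 1) (axis i 1) f p)"

text \<open>The linear operator obtained from the mean curvature operator by freezing the normal
  direction \<open>b\<close>; the viscosity term \<open>k * Lap\<close> absorbs the variation of the true
  normal direction.\<close>

definition Lin :: "real^'n::finite \<Rightarrow> real \<Rightarrow> ((real^'n) \<times> real \<Rightarrow> real) \<Rightarrow> (real^'n) \<times> real \<Rightarrow> real" where
  "Lin b k f p = (1 + k) * Lap f p - D2 b b f p"

lemma linear_dirD_space: "smooth f \<Longrightarrow> linear (\<lambda>v. dirD (v, 0) f p)"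
  by (rule linear_compose[OF _ linear_dirD[OF smooth_differentiable], unfolded o_def])
     (auto intro!: linearI)

lemma dirD_space_sum:
  fixes v :: "real^'n::finite"
  assumes "smooth f"
  shows "dirD (v, 0) f p = (\<Sum>i\<in>UNIV. v $ i * Dx i f p)"
proof -
  interpret linear "\<lambda>v. dirD (v, 0) f p" by (rule linear_dirD_space[OF assms])
  have "dirD (v, 0) f p = dirD ((\<Sum>i\<in>UNIV. v $ i *\<^sub>R axis i 1), 0) f p"
    using basis_expansion[of v] by (simp add: scalar_mult_eq_scaleR)
  also have "\<dots> = (\<Sum>i\<in>UNIV. v $ i * dirD (axis i 1, 0) f p)"
    by (simp add: sum scale)
  finally show ?thesis by (simp add: Dx_def)
qed

lemma D2_sum:
  assumes "smooth f"
  shows "D2 v w f p = (\<Sum>i\<in>UNIV. \<Sum>j\<in>UNIV. v $ i * w $ j * Dx i (Dx j f) p)"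
proof -
  have sD: "smooth (Dx j f)" for j unfolding Dx_def by (intro smooth_dirD assms)
  have "dirD (w, 0) f = (\<lambda>p. \<Sum>j\<in>UNIV. w $ j * Dx j f p)"
    using dirD_space_sum[OF assms] by auto
  then have "Dx i (dirD (w, 0) f) p = (\<Sum>j\<in>UNIV. w $ j * Dx i (Dx j f) p)" for i
    unfolding Dx_def[of i]
    by (subst \<open>dirD (w, 0) f = _\<close>) (simp add: dirD_sum dirD_cmult smooth_cmult sD)
  then show ?thesis
    unfolding D2_def dirD_space_sum[OF smooth_dirD[OF assms]]
    by (simp add: sum_distrib_left mult.assoc)
qed

text \<open>Passes from coordinates to a form in which the direction enters only through a quadratic
  form, so that it can be perturbed and reversed.\<close>

lemma mcf_op_eq:
  assumes "smooth f"
  shows "mcf_op \<eta> f p = Lap f p - D2 \<eta> \<eta> f p"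
proof -
  have "Lap f p = (\<Sum>i\<in>UNIV. \<Sum>j\<in>UNIV. delta i j * Dx i (Dx j f) p)"
    by (auto simp: Lap_def D2_def Dx_def delta_def if_distrib sum.delta cong: if_cong
        intro!: sum.cong)
       (simp add: if_distribR if_distrib cong: if_cong)
  then show ?thesis
    by (simp add: mcf_op_def D2_sum[OF assms] left_diff_distrib sum_subtractf)
qed

lemma linear_D2_left: "smooth f \<Longrightarrow> linear (\<lambda>v. D2 v w f p)"
  unfolding D2_def by (intro linear_dirD_space smooth_dirD)

lemma linear_D2_right: "smooth f \<Longrightarrow> linear (\<lambda>w. D2 v w f p)"
  unfolding D2_sum
  by (rule linearI) (simp_all add: sum.distrib[symmetric] algebra_simps sum_distrib_left)

lemma D2_add: "smooth f \<Longrightarrow> smooth g \<Longrightarrow> D2 v w (\<lambda>x. f x + g x) p = D2 v w f p + D2 v w g p"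
  by (simp add: D2_def dirD_add smooth_dirD)

lemma D2_cmult: "smooth f \<Longrightarrow> D2 v w (\<lambda>x. c * f x) p = c * D2 v w f p"
  by (simp add: D2_def dirD_cmult smooth_dirD)

lemma Lap_add: "smooth f \<Longrightarrow> smooth g \<Longrightarrow> Lap (\<lambda>x. f x + g x) p = Lap f p + Lap g p"
  by (simp add: Lap_def D2_add sum.distrib)

lemma Lap_cmult: "smooth f \<Longrightarrow> Lap (\<lambda>x. c * f x) p = c * Lap f p"
  by (simp add: Lap_def D2_cmult sum_distrib_left)

lemma Lin_add: "smooth f \<Longrightarrow> smooth g \<Longrightarrow> Lin b k (\<lambda>x. f x + g x) p = Lin b k f p + Lin b k g p"
  by (simp add: Lin_def D2_add Lap_add algebra_simps)

lemma Lin_cmult: "smooth f \<Longrightarrow> Lin b k (\<lambda>x. c * f x) p = c * Lin b k f p"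
  by (simp add: Lin_def D2_cmult Lap_cmult algebra_simps)

text \<open>The largest eigenvalue is at most the trace. Instead of diagonalising, one sums over all
  pairs \<open>i\<close>, \<open>j\<close> the nonnegative values of the form at the vector with
  entry \<open>d $ j\<close> in place \<open>i\<close> and \<open>- d $ i\<close> in place
  \<open>j\<close>.\<close>

lemma psd_le_trace:
  fixes X :: "real^'n::finite \<Rightarrow> real^'n \<Rightarrow> real"
  assumes l: "\<And>w. linear (\<lambda>v. X v w)" and r: "\<And>v. linear (X v)"
    and psd: "\<And>v. 0 \<le> X v v"
  shows "X d d \<le> (norm d)\<^sup>2 * (\<Sum>i\<in>UNIV. X (axis i 1) (axis i 1))"
proof -
  let ?e = "\<lambda>i::'n. axis i 1 :: real^'n"
  note lin = linear_add[OF l] linear_add[OF r] linear_scale[OF l] linear_scale[OF r]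
    linear_diff[OF l] linear_diff[OF r]
  have d: "d = (\<Sum>i\<in>UNIV. d $ i *\<^sub>R ?e i)"
    using basis_expansion[of d] by (simp add: scalar_mult_eq_scaleR)
  have "X d d = X (\<Sum>i\<in>UNIV. d $ i *\<^sub>R ?e i) (\<Sum>j\<in>UNIV. d $ j *\<^sub>R ?e j)"
    using d by simp
  also have "\<dots> = (\<Sum>i\<in>UNIV. \<Sum>j\<in>UNIV. d $ i * d $ j * X (?e i) (?e j))"
    by (simp only: linear_sum[OF l] lin(3), simp only: linear_sum[OF r] lin(4))
       (simp add: sum_distrib_left mult.assoc)
  finally have Xd: "X d d = (\<Sum>i\<in>UNIV. \<Sum>j\<in>UNIV. d $ i * d $ j * X (?e i) (?e j))" .
  have swap: "(\<Sum>i\<in>UNIV. \<Sum>j\<in>UNIV. d $ i * d $ j * X (?e j) (?e i)) = X d d"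
    unfolding Xd by (subst sum.swap) (simp add: mult.commute mult.left_commute)
  \<comment> \<open>\<open>X\<close> may be asymmetric, so the double sum is averaged with its
    transpose before it is estimated pairwise.\<close>
  have "2 * X d d = (\<Sum>i\<in>UNIV. \<Sum>j\<in>UNIV. d $ i * d $ j * (X (?e i) (?e j) + X (?e j) (?e i)))"
    by (simp add: distrib_left sum.distrib swap flip: Xd)
  also have "\<dots> \<le> (\<Sum>i\<in>UNIV. \<Sum>j\<in>UNIV. (d $ j)\<^sup>2 * X (?e i) (?e i) + (d $ i)\<^sup>2 * X (?e j) (?e j))"
  proof (intro sum_mono)
    fix i j
    have "0 \<le> X (d $ j *\<^sub>R ?e i - d $ i *\<^sub>R ?e j) (d $ j *\<^sub>R ?e i - d $ i *\<^sub>R ?e j)"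
      by (rule psd)
    then show "d $ i * d $ j * (X (?e i) (?e j) + X (?e j) (?e i))
        \<le> (d $ j)\<^sup>2 * X (?e i) (?e i) + (d $ i)\<^sup>2 * X (?e j) (?e j)"
      by (simp add: lin algebra_simps power2_eq_square)
  qed
  also have "\<dots> = 2 * ((\<Sum>i\<in>UNIV. (d $ i)\<^sup>2) * (\<Sum>i\<in>UNIV. X (?e i) (?e i)))"
    by (simp add: sum.distrib sum_product mult.commute)
       (subst (2) sum.swap, simp add: mult.commute)
  also have "(\<Sum>i\<in>UNIV. (d $ i)\<^sup>2) = (norm d)\<^sup>2"
    by (simp add: norm_vec_def L2_set_def sum_nonneg)
  finally show ?thesis by simp
qed

text \<open>Expanding at \<open>b = a + d\<close>, the cross terms are split by Young's inequality
  with parameter \<open>m\<close>; what remains is controlled by the trace through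
  \<open>psd_le_trace\<close>.\<close>

lemma psd_direction_perturb:
  fixes X :: "real^'n::finite \<Rightarrow> real^'n \<Rightarrow> real"
  assumes l: "\<And>w. linear (\<lambda>v. X v w)" and r: "\<And>v. linear (X v)"
    and psd: "\<And>v. 0 \<le> X v v" and "m > 0" and a: "norm a \<le> 1"
  shows "X b b \<le> X a a + (m + (1 + 1 / m) * (norm (b - a))\<^sup>2) * (\<Sum>i\<in>UNIV. X (axis i 1) (axis i 1))"
proof -
  let ?T = "\<Sum>i\<in>UNIV. X (axis i 1) (axis i 1)"
  note lin = linear_add[OF l] linear_add[OF r] linear_scale[OF l] linear_scale[OF r]
    linear_diff[OF l] linear_diff[OF r]
  define d where "d = b - a"
  have b: "b = a + d" by (simp add: d_def)
  have T: "?T \<ge> 0" by (intro sum_nonneg psd)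
  \<comment> \<open>Positivity at this vector is Young's inequality for the cross terms.\<close>
  have "0 \<le> X (m *\<^sub>R a - d) (m *\<^sub>R a - d)" by (rule psd)
  then have "m * (X a d + X d a) \<le> m * (m * X a a) + X d d"
    by (simp add: lin algebra_simps)
  then have "X a d + X d a \<le> m * X a a + X d d / m"
    using \<open>m > 0\<close> by (simp add: field_simps)
  then have "X b b \<le> X a a + m * X a a + (1 + 1 / m) * X d d"
    unfolding b by (simp add: lin algebra_simps)
  moreover have "X a a \<le> 1 * ?T"
    using psd_le_trace[OF l r psd, of a] a T
    by (meson mult_right_mono norm_ge_zero order_trans power_le_one)
  then have "m * X a a \<le> m * ?T" using \<open>m > 0\<close> by simp
  moreover have "(1 + 1 / m) * X d d \<le> (1 + 1 / m) * ((norm d)\<^sup>2 * ?T)"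
    using psd_le_trace[OF l r psd, of d] \<open>m > 0\<close> by (intro mult_left_mono) auto
  ultimately show ?thesis by (simp add: d_def algebra_simps)
qed

lemma touching_below_quadratic:
  fixes x :: "real^'n::finite"
  assumes "smooth f" "d > 0"
    and low: "\<And>v. norm v < d \<Longrightarrow> f (x + v, t) \<ge> f (x, t) + a \<bullet> v - m * (norm v)\<^sup>2"
  shows "grad_x f (x, t) = a" "D2 v v f (x, t) \<ge> - 2 * m * (norm v)\<^sup>2"
proof -
  have both: "dirD (v, 0) f (x, t) = a \<bullet> v \<and> D2 v v f (x, t) \<ge> - 2 * m * (norm v)\<^sup>2" for v
  proof -
    define F where "F s = f ((x, t) + s *\<^sub>R (v, 0))" for s
    define F' where "F' s = dirD (v, 0) f ((x, t) + s *\<^sub>R (v, 0))" for s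
    have 1: "(F has_real_derivative F' s) (at s)" for s
      unfolding F_def F'_def by (rule has_real_derivative_line[OF assms(1)])
    have 2: "(F' has_real_derivative D2 v v f (x, t)) (at 0)"
      using has_real_derivative_line[OF smooth_dirD[OF assms(1)], of "(v,0)" "(x,t)" "(v,0)" 0]
      unfolding F'_def D2_def by simp
    \<comment> \<open>The summand \<open>1\<close> avoids a division by zero when
      \<open>v = 0\<close>.\<close>
    have d': "d / (norm v + 1) > 0" using \<open>d > 0\<close>
      by (simp add: add_nonneg_pos)
    have 3: "F s \<ge> F 0 + (a \<bullet> v) * s - (m * (norm v)\<^sup>2) * s\<^sup>2" if "\<bar>s\<bar> < d / (norm v + 1)" for s
    proof -
      have "\<bar>s\<bar> * (norm v + 1) < d"
        using that by (simp add: pos_less_divide_eq add_nonneg_pos)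
      then have "norm (s *\<^sub>R v) < d" by (simp add: algebra_simps)
      from low[OF this] show ?thesis
        by (simp add: F_def power_mult_distrib mult.commute mult.left_commute)
    qed
    show ?thesis
      using second_order_lower[OF 1 2 d' 3] by (simp add: F'_def mult.assoc)
  qed
  show "grad_x f (x, t) = a"
    by (rule vec_eq_iff[THEN iffD2]) (use both in \<open>simp add: grad_x_def Dx_def inner_axis\<close>)
  show "D2 v v f (x, t) \<ge> - 2 * m * (norm v)\<^sup>2" using both by blast
qed

text \<open>Adding \<open>2 * m\<close> times the identity makes the Hessian a nonnegative form. At
  the unit vectors \<open>a\<close> and \<open>b\<close> this shift is the same and cancels; in the
  trace it leaves \<open>2 * m * n\<close> with \<open>n\<close> the dimension, which accounts for
  the error term. Half of \<open>k\<close> pays for the Young parameter, the other half for the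
  distance of \<open>a\<close> and \<open>b\<close>.\<close>

lemma Lap_D2_perturb:
  fixes f :: "(real^'n::finite) \<times> real \<Rightarrow> real"
  assumes f: "smooth f" and low: "\<And>v. D2 v v f p \<ge> - 2 * m * (norm v)\<^sup>2"
    and "k > 0" and a: "norm a = 1" and b: "norm b = 1"
    and ab: "(1 + 2 / k) * (norm (b - a))\<^sup>2 \<le> k / 2"
  shows "Lap f p - D2 a a f p \<le> Lin b k f p + 2 * m * real CARD('n) * k"
proof -
  define X where "X v w = D2 v w f p + 2 * m * (v \<bullet> w)" for v w
  have l: "linear (\<lambda>v. X v w)" and r: "linear (X v)" for v w
    unfolding X_def
    by (auto intro!: linearI simp: linear_add[OF linear_D2_left[OF f]]
        linear_scale[OF linear_D2_left[OF f]] linear_add[OF linear_D2_right[OF f]]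
        linear_scale[OF linear_D2_right[OF f]] algebra_simps)
  have psd: "0 \<le> X v v" for v
    using low[of v] by (simp add: X_def power2_norm_eq_inner)
  let ?T = "\<Sum>i\<in>UNIV. X (axis i 1) (axis i 1)"
  have T: "?T = Lap f p + 2 * m * real CARD('n)"
    by (simp add: X_def Lap_def sum.distrib inner_axis_axis)
  have "?T \<ge> 0" by (intro sum_nonneg psd)
  have "X b b \<le> X a a + (k / 2 + (1 + 1 / (k / 2)) * (norm (b - a))\<^sup>2) * ?T"
    using \<open>k > 0\<close> a by (intro psd_direction_perturb l r psd) auto
  also have "\<dots> \<le> X a a + k * ?T"
    using ab \<open>?T \<ge> 0\<close> by (intro add_left_mono mult_right_mono) auto
  finally have "D2 b b f p \<le> D2 a a f p + k * ?T"
    using a b by (simp add: X_def flip: power2_norm_eq_inner)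
  then show ?thesis unfolding T Lin_def by (simp add: algebra_simps)
qed

lemma Lin_nonneg:
  fixes f :: "(real^'n::finite) \<times> real \<Rightarrow> real"
  assumes f: "smooth f" and low: "\<And>v. D2 v v f p \<ge> 0" and "k \<ge> 0" and b: "norm b \<le> 1"
  shows "Lin b k f p \<ge> 0"
proof -
  have L: "Lap f p \<ge> 0" unfolding Lap_def by (intro sum_nonneg low)
  have "D2 b b f p \<le> (norm b)\<^sup>2 * Lap f p"
    unfolding Lap_def
    using linear_D2_left[OF f] linear_D2_right[OF f] low by (intro psd_le_trace) auto
  also have "\<dots> \<le> 1 * Lap f p"
    using L b by (intro mult_right_mono) (auto simp: power_le_one)
  finally show ?thesis using L \<open>k \<ge> 0\<close> unfolding Lin_def
    by (simp add: algebra_simps add_increasing2)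
qed

subsection \<open>Trigonometric solutions of the frozen linear equation\<close>

lemma Dt_add: "smooth f \<Longrightarrow> smooth g \<Longrightarrow> Dt (\<lambda>x. f x + g x) p = Dt f p + Dt g p"
  by (simp add: Dt_def dirD_add)

lemma Dt_cmult: "smooth f \<Longrightarrow> Dt (\<lambda>x. c * f x) p = c * Dt f p"
  by (simp add: Dt_def dirD_cmult)

text \<open>The free phase makes the family closed under spatial differentiation (a quarter period)
  and under translation, so sines need no separate treatment.\<close>

definition wave :: "real \<Rightarrow> real^'n::finite \<Rightarrow> real \<Rightarrow> real \<Rightarrow> (real^'n) \<times> real \<Rightarrow> real" where
  "wave A k \<theta> m p = A * cos (k \<bullet> fst p + \<theta>) * exp (m * snd p)"

lemma dirD_wave:
  "dirD w (wave A k \<theta> m) =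
    (\<lambda>p. wave (A * (k \<bullet> fst w)) k (\<theta> + pi / 2) m p + wave (A * m * snd w) k \<theta> m p)"
proof
  fix p
  have "(wave A k \<theta> m has_derivative
      (\<lambda>w. - (A * (k \<bullet> fst w) * sin (k \<bullet> fst p + \<theta>)) * exp (m * snd p)
         + A * cos (k \<bullet> fst p + \<theta>) * (exp (m * snd p) * (m * snd w)))) (at p)"
    unfolding wave_def
    by (auto intro!: derivative_eq_intros simp: algebra_simps)
  from dirD_eqI[OF this, of w]
  show "dirD w (wave A k \<theta> m) p =
      wave (A * (k \<bullet> fst w)) k (\<theta> + pi / 2) m p + wave (A * m * snd w) k \<theta> m p"
    by (simp add: wave_def cos_add sin_add algebra_simps)
qed

lemma dirD_wave_space: "dirD (v, 0) (wave A k \<theta> m) = wave (A * (k \<bullet> v)) k (\<theta> + pi / 2) m"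
  by (simp add: dirD_wave fun_eq_iff) (simp add: wave_def)

inductive_set wave_sums :: "((real^'n::finite) \<times> real \<Rightarrow> real) set" where
  base: "wave A k \<theta> m \<in> wave_sums"
| add: "f \<in> wave_sums \<Longrightarrow> g \<in> wave_sums \<Longrightarrow> (\<lambda>x. f x + g x) \<in> wave_sums"

lemma wave_differentiable: "wave A k \<theta> m differentiable (at x)"
  unfolding wave_def differentiable_def
  by (rule exI) (auto intro!: derivative_eq_intros)

lemma wave_sums_differentiable: "f \<in> wave_sums \<Longrightarrow> f differentiable (at x)"
  by (induction rule: wave_sums.induct) (auto intro: wave_differentiable)

lemma smooth_wave: "smooth (wave A k \<theta> m)"
proof (rule smooth_coinduct[of _ wave_sums])
  fix g :: "(real^'a) \<times> real \<Rightarrow> real" and v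
  assume "g \<in> wave_sums"
  then show "dirD v g \<in> wave_sums"
  proof (induction rule: wave_sums.induct)
    case (base A k \<theta> m)
    show ?case unfolding dirD_wave by (intro wave_sums.intros)
  next
    case (add f g)
    have "dirD v (\<lambda>x. f x + g x) = (\<lambda>x. dirD v f x + dirD v g x)"
      by (rule ext, rule dirD_eqI, rule has_derivative_add)
         (intro has_derivative_dirD wave_sums_differentiable add)+
    then show ?case using add by (simp add: wave_sums.add)
  qed
qed (auto intro: wave_sums.base wave_sums_differentiable)

lemma D2_wave: "D2 v w (wave A k \<theta> m) p = - (k \<bullet> v) * (k \<bullet> w) * wave A k \<theta> m p"
  unfolding D2_def dirD_wave_space
  by (simp add: wave_def cos_add sin_add algebra_simps)

lemma Dt_wave: "Dt (wave A k \<theta> m) p = m * wave A k \<theta> m p"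
  unfolding Dt_def dirD_wave by (simp add: wave_def)

text \<open>The Fourier symbol of \<open>Lin b \<kappa>\<close>, hence the exponent with which a
  wave of frequency \<open>k\<close> evolves.\<close>

definition rate :: "real^'n::finite \<Rightarrow> real \<Rightarrow> real^'n \<Rightarrow> real" where
  "rate b \<kappa> k = (k \<bullet> b)\<^sup>2 - (1 + \<kappa>) * (k \<bullet> k)"

lemma Lin_wave: "Lin b \<kappa> (wave A k \<theta> m) p = rate b \<kappa> k * wave A k \<theta> m p"
proof -
  have "Lap (wave A k \<theta> m) p = (\<Sum>i\<in>UNIV. - (k $ i * k $ i) * wave A k \<theta> m p)"
    by (simp add: Lap_def D2_wave inner_axis)
  also have "\<dots> = - (k \<bullet> k) * wave A k \<theta> m p"
    by (simp add: inner_vec_def sum_distrib_right sum_negf)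
  finally show ?thesis
    by (simp add: Lin_def D2_wave rate_def power2_eq_square algebra_simps)
qed

text \<open>Tying each exponent to its frequency makes every member an exact solution for all times;
  only the datum at time \<open>0\<close> remains to be fitted.\<close>

inductive_set heat :: "real^'n::finite \<Rightarrow> real \<Rightarrow> ((real^'n) \<times> real \<Rightarrow> real) set"
  for b :: "real^'n" and \<kappa> :: real where
  base: "wave A k \<theta> (rate b \<kappa> k) \<in> heat b \<kappa>"
| add: "f \<in> heat b \<kappa> \<Longrightarrow> g \<in> heat b \<kappa> \<Longrightarrow> (\<lambda>x. f x + g x) \<in> heat b \<kappa>"

lemma heat_smooth: "f \<in> heat b \<kappa> \<Longrightarrow> smooth f"
  by (induction rule: heat.induct) (auto intro: smooth_wave smooth_add)

lemma heat_equation: "f \<in> heat b \<kappa> \<Longrightarrow> Dt f p = Lin b \<kappa> f p"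
  by (induction rule: heat.induct) (auto simp: Dt_wave Lin_wave Dt_add Lin_add heat_smooth)

lemma heat_shift: "f \<in> heat b \<kappa> \<Longrightarrow> (\<lambda>p. f (p + a)) \<in> heat b \<kappa>"
proof (induction rule: heat.induct)
  case (base A k \<theta>)
  have "(\<lambda>p. wave A k \<theta> (rate b \<kappa> k) (p + a)) =
      wave (A * exp (rate b \<kappa> k * snd a)) k (\<theta> + k \<bullet> fst a) (rate b \<kappa> k)"
    by (simp add: wave_def fun_eq_iff inner_add_right algebra_simps exp_add)
  then show ?case by (simp add: heat.base)
next
  case (add f g)
  then show ?case using heat.add by blast
qed

lemma heat_minus: "f \<in> heat b \<kappa> \<Longrightarrow> (\<lambda>p. - f p) \<in> heat b \<kappa>"
proof (induction rule: heat.induct)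
  case (base A k \<theta>)
  have "(\<lambda>p. - wave A k \<theta> (rate b \<kappa> k) p) = wave (- A) k \<theta> (rate b \<kappa> k)"
    by (simp add: wave_def fun_eq_iff)
  then show ?case by (simp add: heat.base)
next
  case (add f g)
  then show ?case using heat.add by fastforce
qed

text \<open>By Cauchy-Schwarz the symbol is nonpositive for these \<open>b\<close> and \<kappa>, so
  no wave grows in time.\<close>

lemma heat_bounded:
  assumes "f \<in> heat b \<kappa>" "norm b \<le> 1" "\<kappa> \<ge> 0"
  shows "\<exists>B\<ge>0. \<forall>x t. t \<ge> 0 \<longrightarrow> \<bar>f (x, t)\<bar> \<le> B"
  using assms(1)
proof (induction rule: heat.induct)
  case (base A k \<theta>)
  have "(k \<bullet> b)\<^sup>2 \<le> (norm k * norm b)\<^sup>2"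
    using Cauchy_Schwarz_ineq2[of k b] by (simp add: abs_le_square_iff[symmetric])
  also have "\<dots> \<le> (norm k * 1)\<^sup>2"
    using assms(2) by (intro power_mono mult_left_mono) auto
  finally have "rate b \<kappa> k \<le> 0"
    using \<open>\<kappa> \<ge> 0\<close> by (simp add: rate_def power2_norm_eq_inner algebra_simps add_increasing2)
  then have "\<bar>wave A k \<theta> (rate b \<kappa> k) (x, t)\<bar> \<le> \<bar>A\<bar> * 1 * 1" if "t \<ge> 0" for x t
    unfolding wave_def abs_mult using that
    by (intro mult_mono) (auto simp: mult_nonpos_nonneg)
  then show ?case by (intro exI[of _ "\<bar>A\<bar>"]) auto
next
  case (add f g)
  then obtain B1 B2 where "B1 \<ge> 0" "B2 \<ge> 0" "\<forall>x t. t \<ge> 0 \<longrightarrow> \<bar>f (x, t)\<bar> \<le> B1"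
    "\<forall>x t. t \<ge> 0 \<longrightarrow> \<bar>g (x, t)\<bar> \<le> B2" by auto
  then have "\<bar>f (x, t) + g (x, t)\<bar> \<le> B1 + B2" if "t \<ge> 0" for x t
    using that by (intro order_trans[OF abs_triangle_ineq] add_mono) auto
  then show ?case
    using \<open>B1 \<ge> 0\<close> \<open>B2 \<ge> 0\<close> by (intro exI[of _ "B1 + B2"]) auto
qed

lemma heat_const: "\<exists>h\<in>heat b \<kappa>. \<forall>x. h (x, 0) = c"
  by (rule bexI[OF _ heat.base[of c 0 0]]) (simp add: wave_def)

text \<open>A product of solutions is in general not a solution, but its datum at time
  \<open>0\<close> is again a trigonometric sum by the product-to-sum formula, and each new
  frequency can be given its own exponent. This provides the ring structure for
  Stone-Weierstrass.\<close>

lemma heat_mult_initial: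
  assumes "f \<in> heat b \<kappa>" "g \<in> heat b \<kappa>"
  shows "\<exists>h\<in>heat b \<kappa>. \<forall>x. h (x, 0) = f (x, 0) * g (x, 0)"
  using assms(1)
proof (induction rule: heat.induct)
  case (base A k \<theta>)
  show ?case using assms(2)
  proof (induction rule: heat.induct)
    case (base A' k' \<theta>')
    let ?h = "\<lambda>p. wave (A * A' / 2) (k + k') (\<theta> + \<theta>') (rate b \<kappa> (k + k')) p
      + wave (A * A' / 2) (k - k') (\<theta> - \<theta>') (rate b \<kappa> (k - k')) p"
    have "?h (x, 0) = wave A k \<theta> (rate b \<kappa> k) (x, 0) * wave A' k' \<theta>' (rate b \<kappa> k') (x, 0)" for x
    proof -
      have "cos ((k + k') \<bullet> x + (\<theta> + \<theta>')) + cos ((k - k') \<bullet> x + (\<theta> - \<theta>'))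
          = 2 * cos (k \<bullet> x + \<theta>) * cos (k' \<bullet> x + \<theta>')"
        using cos_times_cos[of "k \<bullet> x + \<theta>" "k' \<bullet> x + \<theta>'"]
        by (simp add: inner_add_left inner_diff_left algebra_simps)
      then have "A * A' / 2 * (cos ((k + k') \<bullet> x + (\<theta> + \<theta>')) + cos ((k - k') \<bullet> x + (\<theta> - \<theta>')))
          = A * A' / 2 * (2 * cos (k \<bullet> x + \<theta>) * cos (k' \<bullet> x + \<theta>'))" by simp
      then show ?thesis by (simp add: wave_def distrib_left)
    qed
    then have "\<forall>x. ?h (x, 0) = wave A k \<theta> (rate b \<kappa> k) (x, 0) * wave A' k' \<theta>' (rate b \<kappa> k') (x, 0)"
      by (rule allI)
    then show ?case by (rule bexI[of _ ?h, rotated 1, OF heat.add[OF heat.base heat.base]])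
  next
    case (add f1 f2)
    then obtain h1 h2 where "h1 \<in> heat b \<kappa>" "h2 \<in> heat b \<kappa>"
      "\<forall>x. h1 (x, 0) = wave A k \<theta> (rate b \<kappa> k) (x, 0) * f1 (x, 0)"
      "\<forall>x. h2 (x, 0) = wave A k \<theta> (rate b \<kappa> k) (x, 0) * f2 (x, 0)" by blast
    then show ?case
      by (intro bexI[of _ "\<lambda>x. h1 x + h2 x"]) (auto simp: algebra_simps intro: heat.add)
  qed
next
  case (add f1 f2)
  then obtain h1 h2 where "h1 \<in> heat b \<kappa>" "h2 \<in> heat b \<kappa>"
    "\<forall>x. h1 (x, 0) = f1 (x, 0) * g (x, 0)"
    "\<forall>x. h2 (x, 0) = f2 (x, 0) * g (x, 0)" by blast
  then show ?case
    by (intro bexI[of _ "\<lambda>x. h1 x + h2 x"]) (auto simp: algebra_simps intro: heat.add)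
qed

text \<open>Composing a polynomial on the cube with \<open>sin\<close> in each coordinate gives a trigonometric
  sum whose global supremum is controlled by the cube; this is what makes the approximation of
  a local datum usable as initial datum on the whole space.\<close>

lemma heat_approximation:
  fixes f :: "real^'n::finite \<Rightarrow> real"
  assumes cont: "continuous_on UNIV f" and K: "\<And>x. \<bar>f x\<bar> \<le> K" and "e > 0"
  shows "\<exists>h\<in>heat b \<kappa>. (\<forall>x. norm x \<le> 1 \<longrightarrow> \<bar>h (x, 0) - f x\<bar> \<le> e) \<and> (\<forall>x. \<bar>h (x, 0)\<bar> \<le> K + e)"
proof -
  define \<Theta> :: "real^'n \<Rightarrow> real^'n" where "\<Theta> x = (\<chi> i. sin (x $ i))" for x
  define Q :: "(real^'n) set" where "Q = cbox (- 1) 1"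
  \<comment> \<open>Stone-Weierstrass is applied on the compact cube, to functions that become data
    of exact solutions after composition with \<Theta>.\<close>
  define R where "R = {P :: real^'n \<Rightarrow> real. continuous_on Q P \<and> (\<exists>h\<in>heat b \<kappa>. \<forall>x. P (\<Theta> x) = h (x, 0))}"
  \<comment> \<open>On the unit ball \<open>arcsin\<close> undoes \<open>sin\<close> because the
    coordinates stay below \<open>pi / 2\<close>; elsewhere \<open>F\<close> is still bounded by
    \<open>K\<close>, which yields the global bound on \<open>h\<close>.\<close>
  define F where "F y = f (\<chi> i. arcsin (y $ i))" for y :: "real^'n"
  have mem_Q: "y \<in> Q \<longleftrightarrow> (\<forall>i. -1 \<le> y $ i \<and> y $ i \<le> 1)" for y
    by (simp add: Q_def mem_box_cart)
  interpret function_ring_on R Q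
  proof
    show "compact Q" unfolding Q_def by (rule compact_cbox)
    show "continuous_on Q g" if "g \<in> R" for g using that by (simp add: R_def)
    show "(\<lambda>x. g x + h x) \<in> R" if gh: "g \<in> R" "h \<in> R" for g h
    proof -
      from gh obtain g' h' where *: "g' \<in> heat b \<kappa>" "h' \<in> heat b \<kappa>"
        "\<forall>x. g (\<Theta> x) = g' (x, 0)" "\<forall>x. h (\<Theta> x) = h' (x, 0)" by (auto simp: R_def)
      show ?thesis using gh * unfolding R_def
        by (auto intro!: continuous_on_add bexI[OF _ heat.add[OF *(1,2)]])
    qed
    show "(\<lambda>x. g x * h x) \<in> R" if gh: "g \<in> R" "h \<in> R" for g h
    proof -
      from gh obtain g' h' where *: "g' \<in> heat b \<kappa>" "h' \<in> heat b \<kappa>"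
        "\<forall>x. g (\<Theta> x) = g' (x, 0)" "\<forall>x. h (\<Theta> x) = h' (x, 0)" by (auto simp: R_def)
      obtain k where "k \<in> heat b \<kappa>" "\<forall>x. k (x, 0) = g' (x, 0) * h' (x, 0)"
        using heat_mult_initial[OF *(1,2)] by blast
      then show ?thesis using gh * unfolding R_def
        by (auto intro!: continuous_on_mult bexI[of _ k])
    qed
    show "(\<lambda>_. c) \<in> R" for c unfolding R_def using heat_const[of b \<kappa> c] by auto
    show "\<exists>g\<in>R. g x \<noteq> g y" if ne: "x \<noteq> y" for x y
    proof -
      obtain i where i: "x $ i \<noteq> y $ i" using ne by (auto simp: vec_eq_iff)
      have "\<exists>h\<in>heat b \<kappa>. \<forall>x. \<Theta> x $ i = h (x, 0)"
        \<comment> \<open>The coordinate functions separate points; composed with \<Theta> they are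
          sines, that is waves with phase \<open>- pi / 2\<close>.\<close>
        by (rule bexI[OF _ heat.base[of 1 "axis i 1" "- (pi / 2)"]])
           (simp add: wave_def \<Theta>_def inner_axis' cos_diff)
      moreover have "continuous_on Q (\<lambda>z. z $ i)"
        by (intro continuous_on_component continuous_on_id)
      ultimately have "(\<lambda>z. z $ i) \<in> R"
        by (simp add: R_def)
      with i show ?thesis by (intro bexI[of _ "\<lambda>z. z $ i"])
    qed
  qed
  have "continuous_on Q F"
    unfolding F_def
    by (rule continuous_on_compose2[OF cont], intro continuous_on_vec_lambda continuous_on_arcsin
        continuous_on_component continuous_on_id) (auto simp: mem_Q)
  then obtain P where P: "P \<in> R" "\<And>y. y \<in> Q \<Longrightarrow> \<bar>F y - P y\<bar> < e"
    using Stone_Weierstrass_basic[of F e] \<open>e > 0\<close> by blast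
  then obtain h where h: "h \<in> heat b \<kappa>" "\<And>x. P (\<Theta> x) = h (x, 0)" by (auto simp: R_def)
  have \<Theta>Q: "\<Theta> x \<in> Q" for x by (simp add: mem_Q \<Theta>_def)
  have "\<bar>h (x, 0)\<bar> \<le> K + e" for x
    using P(2)[OF \<Theta>Q[of x]] K[of "\<chi> i. arcsin (\<Theta> x $ i)"] h(2)[of x] by (simp add: F_def)
  moreover have "\<bar>h (x, 0) - f x\<bar> \<le> e" if "norm x \<le> 1" for x
  proof -
    have "- (pi / 2) \<le> x $ i \<and> x $ i \<le> pi / 2" for i
      using component_le_norm_cart[of x i] that pi_ge_two by linarith
    then have "arcsin (sin (x $ i)) = x $ i" for i
      by (simp add: arcsin_sin)
    then have "F (\<Theta> x) = f x" by (simp add: F_def \<Theta>_def)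
    then show ?thesis using P(2)[OF \<Theta>Q[of x]] h(2)[of x] by simp
  qed
  ultimately show ?thesis using h(1) by blast
qed

subsection \<open>Barriers and the maximum principle\<close>

definition nsq :: "real^'n::finite \<Rightarrow> (real^'n) \<times> real \<Rightarrow> real" where
  "nsq a p = (norm (fst p - a))\<^sup>2"

lemma smooth_nsq:
  fixes a :: "real^'n::finite"
  shows "smooth (nsq a)"
proof -
  have "bounded_linear (\<lambda>p :: (real^'n) \<times> real. fst p $ i)" for i
    by (intro bounded_linear_compose[OF bounded_linear_vec_nth] bounded_linear_fst)
  then have "smooth (\<lambda>p :: (real^'n) \<times> real. \<Sum>i\<in>UNIV. (fst p $ i + - (a $ i)) * (fst p $ i + - (a $ i)))"
    by (intro smooth_sum smooth_mult smooth_affine)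
  also have "(\<lambda>p :: (real^'n) \<times> real. \<Sum>i\<in>UNIV. (fst p $ i + - (a $ i)) * (fst p $ i + - (a $ i))) = nsq a"
    by (simp add: fun_eq_iff nsq_def power2_norm_eq_inner inner_vec_def)
  finally show ?thesis .
qed

lemma dirD_nsq: "dirD w (nsq a) p = 2 * ((fst p - a) \<bullet> fst w)"
  unfolding nsq_def power2_norm_eq_inner
  by (rule dirD_eqI) (auto intro!: derivative_eq_intros simp: inner_commute)

lemma D2_nsq: "D2 v w (nsq a) p = 2 * (v \<bullet> w)"
proof -
  have *: "dirD (w, 0) (nsq a) = (\<lambda>p. 2 * (fst p \<bullet> w) + - 2 * (a \<bullet> w))"
    by (simp add: dirD_nsq fun_eq_iff inner_diff_left)
  have "bounded_linear (\<lambda>p :: (real^'a) \<times> real. 2 * (fst p \<bullet> w))"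
    by (intro bounded_linear_intros)
  from dirD_affine[OF this, of "(v, 0)" "- 2 * (a \<bullet> w)"] show ?thesis
    unfolding D2_def * by (simp only: fst_conv)
qed

lemma smooth_time: "smooth (\<lambda>p :: ('a::real_normed_vector) \<times> real. A + B * (snd p - t0))"
proof -
  have "smooth (\<lambda>p :: 'a \<times> real. B * snd p + (A - B * t0))"
    by (intro smooth_affine bounded_linear_intros)
  then show ?thesis by (simp add: algebra_simps)
qed

lemma dirD_time: "dirD w (\<lambda>p. A + B * (snd p - t0)) = (\<lambda>p. B * snd w)"
  by (rule ext, rule dirD_eqI) (auto intro!: derivative_eq_intros)

lemma D2_time: "D2 v w (\<lambda>p. A + B * (snd p - t0)) p = 0"
  by (simp add: D2_def dirD_time dirD_const)

lemma Lap_time: "Lap (\<lambda>p. A + B * (snd p - t0)) p = 0"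
  by (simp add: Lap_def D2_time)

lemma Lin_time: "Lin b k (\<lambda>p. A + B * (snd p - t0)) p = 0"
  by (simp add: Lin_def D2_time Lap_time)

lemma Dt_time: "Dt (\<lambda>p. A + B * (snd p - t0)) p = B"
  by (simp add: Dt_def dirD_time)

lemma D2_square:
  assumes "smooth f"
  shows "D2 v w (\<lambda>p. f p * f p) p = 2 * f p * D2 v w f p + 2 * dirD (v, 0) f p * dirD (w, 0) f p"
proof -
  have "dirD (w, 0) (\<lambda>p. f p * f p) = (\<lambda>p. 2 * (f p * dirD (w, 0) f p))"
    by (simp add: dirD_mult assms)
  then have "D2 v w (\<lambda>p. f p * f p) p
      = 2 * (f p * dirD (v, 0) (dirD (w, 0) f) p + dirD (v, 0) f p * dirD (w, 0) f p)"
    by (simp only: D2_def dirD_cmult dirD_mult smooth_mult smooth_dirD assms)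
  then show ?thesis by (simp add: D2_def)
qed

text \<open>The redundant coefficients \<open>0\<close> and \<open>1\<close>, here and in \<open>pen\<close> below, keep the affine
  time terms in the syntactic form of \<open>smooth_time\<close>.\<close>

definition bar :: "real^'n::finite \<Rightarrow> real \<Rightarrow> (real^'n) \<times> real \<Rightarrow> real" where
  "bar a t0 p = nsq a p + (0 + (4 * real CARD('n) + 8) * (snd p - t0))"

lemma smooth_bar: "smooth (bar a t0)"
  unfolding bar_def by (intro smooth_add smooth_nsq smooth_time)

lemma dirD_bar_space: "dirD (w, 0) (bar a t0) p = 2 * ((fst p - a) \<bullet> w)"
  unfolding bar_def by (simp only: dirD_add smooth_nsq smooth_time dirD_nsq dirD_time; simp)

lemma D2_bar: "D2 v w (bar a t0) p = 2 * (v \<bullet> w)"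
  unfolding bar_def by (simp only: D2_add smooth_nsq smooth_time D2_nsq D2_time add_0_right)

lemma Dt_bar: "Dt (bar a t0) (p :: (real^'n::finite) \<times> real) = 4 * real CARD('n) + 8"
  unfolding bar_def Dt_def by (simp only: dirD_add smooth_nsq smooth_time dirD_nsq dirD_time; simp)

definition bar2 :: "real^'n::finite \<Rightarrow> real \<Rightarrow> (real^'n) \<times> real \<Rightarrow> real" where
  "bar2 a t0 p = bar a t0 p * bar a t0 p"

lemma smooth_bar2: "smooth (bar2 a t0)"
  unfolding bar2_def by (intro smooth_mult smooth_bar)

lemma bar2_nonneg: "bar2 a t0 p \<ge> 0"
  by (simp add: bar2_def)

text \<open>With \<open>q\<close> the value of \<open>bar\<close> and \<open>n\<close> the
  dimension, the Laplacian is \<open>4 * n * q + 8 * nsq a p\<close>, the subtracted second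
  derivative is nonnegative, and \<open>1 + k\<close> is at most \<open>2\<close>. The time
  coefficient \<open>4 * n + 8\<close> of \<open>bar\<close> is the one for which the resulting
  bound equals the time derivative.\<close>

lemma bar2_supersolution:
  fixes p :: "(real^'n::finite) \<times> real"
  assumes "snd p \<ge> t0" "0 \<le> k" "k \<le> 1"
  shows "Lin b k (bar2 a t0) p \<le> Dt (bar2 a t0) p"
proof -
  define q where "q = bar a t0 p"
  define n where "n = real CARD('n)"
  have nsq: "nsq a p \<le> q" "0 \<le> nsq a p" using assms
    by (auto simp: q_def bar_def nsq_def)
  have "(\<Sum>i\<in>UNIV. ((fst p - a) $ i)\<^sup>2) = nsq a p"
    by (simp add: nsq_def power2_norm_eq_inner inner_vec_def) (simp add: power2_eq_square)
  moreover have "D2 (axis i 1) (axis i 1) (bar2 a t0) p = 4 * q + 8 * ((fst p - a) $ i)\<^sup>2" for i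
    unfolding bar2_def
    by (simp add: D2_square[OF smooth_bar] D2_bar dirD_bar_space inner_axis_axis inner_axis
        q_def power2_eq_square algebra_simps)
  ultimately have L: "Lap (bar2 a t0) p = 4 * n * q + 8 * nsq a p"
    by (simp add: Lap_def sum.distrib n_def flip: sum_distrib_left)
  have "D2 b b (bar2 a t0) p \<ge> 0"
    unfolding bar2_def using nsq
    by (simp add: D2_square[OF smooth_bar] D2_bar dirD_bar_space flip: q_def)
  then have "Lin b k (bar2 a t0) p \<le> (1 + k) * (4 * n * q + 8 * nsq a p)"
    by (simp add: Lin_def L)
  also have "\<dots> \<le> 2 * (4 * n * q + 8 * q)"
    using assms nsq by (intro mult_mono add_mono) (auto simp: n_def)
  also have "\<dots> = Dt (bar2 a t0) p"
  proof -
    have "Dt (bar2 a t0) p = 2 * q * Dt (bar a t0) p"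
      unfolding bar2_def Dt_def by (simp add: dirD_mult smooth_bar q_def)
    then show ?thesis by (simp add: Dt_bar n_def algebra_simps)
  qed
  finally show ?thesis .
qed

lemma continuous_on_smooth: "smooth f \<Longrightarrow> continuous_on S f"
  by (simp add: continuous_at_imp_continuous_on differentiable_imp_continuous_within
      smooth_differentiable)

lemma local_max_atI:
  assumes "open S" "p0 \<in> S" "\<And>p. p \<in> S \<Longrightarrow> w p \<le> w p0"
  shows "local_max_at w p0"
proof -
  obtain d where "d > 0" "ball p0 d \<subseteq> S" using assms open_contains_ball by metis
  then show ?thesis using assms(3) unfolding local_max_at_def
    by (intro exI[of _ d]) (auto simp: subset_eq dist_commute)
qed

text \<open>Only earlier times are compared. It therefore applies at the final time of a cylinder,
  and in \<open>theorem1p2\<close>, where monotonicity of the modulus gives information about the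
  past only.\<close>

lemma Dt_nonneg_of_left_max:
  assumes f: "smooth f" and "s < t" and max: "\<And>t'. s \<le> t' \<Longrightarrow> t' \<le> t \<Longrightarrow> f (x, t') \<le> f (x, t)"
  shows "Dt f (x, t) \<ge> 0"
proof (rule ccontr)
  assume neg: "\<not> ?thesis"
  have "((\<lambda>h. f ((x, t) + h *\<^sub>R (0, 1))) has_real_derivative Dt f (x, t)) (at 0)"
    using has_real_derivative_line[OF f, of "(x,t)" "(0,1)" 0] by (simp add: Dt_def)
  from DERIV_neg_dec_left[OF this] neg obtain d where
    d: "d > 0" "\<And>h. 0 < h \<Longrightarrow> h < d \<Longrightarrow> f (x, t) < f (x, t - h)" by auto
  define h where "h = min (d / 2) (t - s)"
  have "0 < h" "h < d" "h \<le> t - s" using d \<open>s < t\<close> by (auto simp: h_def)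
  then show False using d(2)[of h] max[of "t - h"] by auto
qed

text \<open>Since \<open>C > 0\<close>, the growth of \<open>bar2\<close> beats the bounded
  \<open>f\<close>, so a violation is attained as a maximum in a compact cylinder. There the extra
  slope \<open>e\<close> contradicts the equation for \<open>f\<close> and the supersolution
  property of \<open>bar2\<close>.\<close>

lemma max_principle_strict:
  fixes f :: "(real^'n::finite) \<times> real \<Rightarrow> real"
  assumes f: "smooth f" and eq: "\<And>p. Dt f p = Lin b k f p"
    and bd: "\<And>x t. t \<ge> 0 \<Longrightarrow> f (x, t) \<le> B"
    and b: "norm b \<le> 1" and k: "0 \<le> k" "k \<le> 1" and "C > 0"
    and init: "\<And>x. f (x, 0) \<le> M + C * bar2 0 0 (x, 0)"
    and "t \<ge> 0"
  shows "f (x, t) \<le> M + C * bar2 0 0 (x, t)"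
proof (rule ccontr)
  assume "\<not> ?thesis"
  define x1 t1 where "x1 = x" and "t1 = t"
  define d where "d = f (x1, t1) - (M + C * bar2 0 0 (x1, t1))"
  have "d > 0" using \<open>\<not> _\<close> by (simp add: d_def x1_def t1_def)
  \<comment> \<open>Small enough that subtracting \<open>e * t1\<close> does not destroy the
    violation \<open>d\<close> at \<open>(x1, t1)\<close>.\<close>
  define e where "e = d / (2 * (t1 + 1))"
  have "t1 \<ge> 0" using \<open>t \<ge> 0\<close> by (simp add: t1_def)
  have "e > 0" using \<open>d > 0\<close> \<open>t1 \<ge> 0\<close> by (simp add: e_def)
  have "e * t1 < d" using \<open>d > 0\<close> \<open>t1 \<ge> 0\<close>
    by (simp add: e_def field_simps add_nonneg_pos)
  define G where "G p = f p + ((- M + (- e) * (snd p - 0)) + (- C) * bar2 0 0 p)" for p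
  have G1: "G (x1, t1) > 0" using \<open>e * t1 < d\<close> by (simp add: G_def d_def)
  have sG: "smooth G" unfolding G_def
    by (intro smooth_add f smooth_time smooth_cmult smooth_bar2)
  \<comment> \<open>The radius is at least \<open>1\<close>, so beyond it the fourth power of the
    norm dominates the norm itself, hence the last summand of \<open>R\<close>, and
    \<open>C * bar2\<close> outweighs both bounds.\<close>
  define R where "R = norm x1 + 1 + (\<bar>B\<bar> + \<bar>M\<bar>) / C"
  have "(\<bar>B\<bar> + \<bar>M\<bar>) / C \<ge> 0" using \<open>C > 0\<close> by auto
  then have R1: "R \<ge> 1" "norm x1 \<le> R" by (auto simp: R_def)
  have far: "G (x, t) \<le> 0" if "norm x \<ge> R" "t \<ge> 0" for x t
  proof -
    have "R \<le> norm x" "1 \<le> norm x" using that R1 by auto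
    then have "R \<le> norm x * norm x * (norm x * norm x)"
      by (smt (verit) mult_le_cancel_left1 mult_le_cancel_right1)
    also have "\<dots> \<le> bar2 0 0 (x, t)" unfolding bar2_def bar_def nsq_def using that
      by (intro mult_mono) (auto simp: power2_eq_square)
    finally have "(\<bar>B\<bar> + \<bar>M\<bar>) / C \<le> bar2 0 0 (x, t)" by (simp add: R_def)
       (smt (verit) norm_ge_zero)
    then have "\<bar>B\<bar> + \<bar>M\<bar> \<le> C * bar2 0 0 (x, t)"
      using \<open>C > 0\<close> by (simp add: field_simps)
    moreover have "e * t \<ge> 0" using \<open>e > 0\<close> that by simp
    ultimately show ?thesis using bd[OF that(2), of x] unfolding G_def by simp
  qed
  let ?S = "cball (0 :: real^'n) R \<times> {0..t1}"
  have "compact ?S" by (intro compact_Times compact_cball compact_Icc)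
  moreover have "(x1, t1) \<in> ?S" using R1 \<open>t1 \<ge> 0\<close> by simp
  ultimately obtain z where z: "z \<in> ?S" "\<And>y. y \<in> ?S \<Longrightarrow> G y \<le> G z"
    using continuous_attains_sup[of ?S G] continuous_on_smooth[OF sG] by blast
  obtain x t where [simp]: "z = (x, t)" by (cases z)
  have Gz: "G (x, t) > 0" using z(2)[of "(x1, t1)"] \<open>(x1, t1) \<in> ?S\<close> G1 by simp
  have t: "0 \<le> t" "t \<le> t1" using z(1) by auto
  have nx: "norm x < R" using far[of x t] Gz t by force
  have "t \<noteq> 0" using init[of x] Gz by (auto simp: G_def)
  then have "t > 0" using t by simp
  have mG: "smooth (\<lambda>p. - G p)" by (rule smooth_minus[OF sG])
  have "Dt G (x, t) \<ge> 0"
    by (rule Dt_nonneg_of_left_max[OF sG \<open>t > 0\<close>]) (use z t in auto)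
  moreover have "Dt G (x, t) = Dt f (x, t) - e - C * Dt (bar2 0 0) (x, t)"
    unfolding G_def by (simp only: Dt_add Dt_cmult f smooth_time smooth_add smooth_cmult smooth_bar2 Dt_time; simp)
  moreover have "Lin b k (\<lambda>p. - G p) (x, t) \<ge> 0"
  proof (rule Lin_nonneg[OF mG])
    fix v
    have "- 2 * 0 * (norm v)\<^sup>2 \<le> D2 v v (\<lambda>p. - G p) (x, t)"
    proof (rule touching_below_quadratic(2)[OF mG, of "R - norm x" x t 0])
      fix v :: "real^'n" assume "norm v < R - norm x"
      then have "(x + v, t) \<in> ?S" using t norm_triangle_ineq[of x v] by simp
      from z(2)[OF this] show "- G (x, t) + 0 \<bullet> v - 0 * (norm v)\<^sup>2 \<le> - G (x + v, t)" by simp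
    qed (use nx in simp)
    then show "D2 v v (\<lambda>p. - G p) (x, t) \<ge> 0" by simp
  qed (use b k in auto)
  moreover have "Lin b k (\<lambda>p. - G p) (x, t) = C * Lin b k (bar2 0 0) (x, t) - Lin b k f (x, t)"
  proof -
    have "Lin b k (\<lambda>p. - 1 * G p) (x, t) = - 1 * Lin b k G (x, t)"
      by (rule Lin_cmult[OF sG])
    moreover have "Lin b k G (x, t) = Lin b k f (x, t) - C * Lin b k (bar2 0 0) (x, t)"
      unfolding G_def by (simp only: Lin_add Lin_cmult f smooth_time smooth_add smooth_cmult smooth_bar2 Lin_time; simp)
    ultimately show ?thesis by simp
  qed
  moreover have "C * Lin b k (bar2 0 0) (x, t) \<le> C * Dt (bar2 0 0) (x, t)"
    using bar2_supersolution[of 0 "(x, t)" k b 0] t k \<open>C > 0\<close> by simp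
  ultimately show False using eq[of "(x, t)"] \<open>e > 0\<close> by simp
qed

text \<open>Also covers \<open>C = 0\<close>, which is the case that turns a bound on initial data
  into a bound for all times.\<close>

lemma max_principle:
  fixes f :: "(real^'n::finite) \<times> real \<Rightarrow> real"
  assumes f: "f \<in> heat b k"
    and b: "norm b \<le> 1" and k: "0 \<le> k" "k \<le> 1" and "C \<ge> 0"
    and init: "\<And>x. f (x, 0) \<le> M + C * bar2 0 0 (x, 0)"
    and "t \<ge> 0"
  shows "f (x, t) \<le> M + C * bar2 0 0 (x, t)"
proof (rule field_le_epsilon)
  fix e :: real assume "e > 0"
  obtain B where B: "\<And>x t. t \<ge> 0 \<Longrightarrow> \<bar>f (x, t)\<bar> \<le> B" using heat_bounded[OF f b k(1)] by auto
  \<comment> \<open>The increment is scaled by the barrier at the point under consideration, so it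
    costs at most \<open>e\<close> there.\<close>
  let ?C = "C + e / (bar2 0 0 (x, t) + 1)"
  have pos: "bar2 0 0 (x, t) + 1 > 0" using bar2_nonneg[of 0 0 "(x, t)"] by simp
  have "?C > 0" using \<open>C \<ge> 0\<close> \<open>e > 0\<close> pos by (simp add: add_nonneg_pos)
  have "f (x, t) \<le> M + ?C * bar2 0 0 (x, t)"
  proof (rule max_principle_strict[OF heat_smooth[OF f] heat_equation[OF f] _ b k \<open>?C > 0\<close>])
    show "f (y, s) \<le> B" if "s \<ge> 0" for y s using B[OF that, of y] by simp
    show "f (y, 0) \<le> M + ?C * bar2 0 0 (y, 0)" for y
    proof -
      have "C * bar2 0 0 (y, 0) \<le> ?C * bar2 0 0 (y, 0)"
        using \<open>e > 0\<close> pos by (intro mult_right_mono bar2_nonneg) simp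
      then show ?thesis using init[of y] by simp
    qed
  qed (use \<open>t \<ge> 0\<close> in auto)
  also have "\<dots> = M + C * bar2 0 0 (x, t) + e * (bar2 0 0 (x, t) / (bar2 0 0 (x, t) + 1))"
    by (simp add: algebra_simps)
  also have "\<dots> \<le> M + C * bar2 0 0 (x, t) + e * 1"
    using \<open>e > 0\<close> pos by (intro add_left_mono mult_left_mono) auto
  finally show "f (x, t) \<le> M + C * bar2 0 0 (x, t) + e" by simp
qed

text \<open>Near \<open>(x0, t0)\<close> the function \<open>w\<close> is a viscosity subsolution of
  the linear equation up to \<open>c0\<close>. An exact solution fitted to \<open>w\<close> at time
  \<open>t0 - \<tau>\<close>, with the errors and the barrier added, is a smooth strict
  supersolution. It can therefore serve as the test function itself, and \<open>w\<close> cannot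
  exceed it in the interior.\<close>

lemma parabolic_bound:
  fixes w :: "real^'n::finite \<Rightarrow> real \<Rightarrow> real"
  assumes cont: "continuous_on (UNIV \<times> {0..}) (\<lambda>(x, t). w x t)"
    and K: "\<And>x t. t \<ge> 0 \<Longrightarrow> \<bar>w x t\<bar> \<le> K"
    and b: "norm b \<le> 1" and k: "0 \<le> k" "k \<le> 1"
    and r: "0 < r" "r \<le> 1" "r \<le> t0"
    and test: "\<And>\<psi> x t. smooth \<psi> \<Longrightarrow> dist x x0 < r \<Longrightarrow> \<bar>t - t0\<bar> < r \<Longrightarrow>
      local_max_at (\<lambda>(x, t). w x t - \<psi> (x, t)) (x, t) \<Longrightarrow> Dt \<psi> (x, t) \<le> Lin b k \<psi> (x, t) + c0"
    and c0: "c0 \<ge> 0" and \<tau>: "0 < \<tau>" "\<tau> < r\<^sup>2" and e: "0 < e" "e < 1"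
    and C: "C * r ^ 4 \<ge> 2 * K + 2" "C \<ge> 0"
  shows "\<exists>h\<in>heat b k. (\<forall>y. norm y \<le> 1 \<longrightarrow> \<bar>h (y, 0) - w (x0 + y) (t0 - \<tau>)\<bar> \<le> e)
      \<and> (\<forall>y. \<bar>h (y, 0)\<bar> \<le> K + e)
      \<and> w x0 t0 \<le> h (0, \<tau>) + e + (c0 + e) * \<tau> + C * bar2 0 0 (0 :: real^'n, \<tau>)"
proof -
  define t1 where "t1 = t0 - \<tau>"
  have "r\<^sup>2 \<le> r" using r by (simp add: power2_eq_square mult_left_le)
  then have t1: "t1 \<ge> 0" "t1 < t0" "t0 - r < t1" "t1 + r\<^sup>2 > t0" using r \<tau> by (auto simp: t1_def)
  have "continuous_on UNIV (\<lambda>y. (\<lambda>(x, t). w x t) (x0 + y, t1))"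
    by (rule continuous_on_compose2[OF cont]) (auto intro!: continuous_intros simp: t1)
  then have cw: "continuous_on UNIV (\<lambda>y. w (x0 + y) t1)" by simp
  obtain h where h: "h \<in> heat b k"
    and h1: "\<And>y. norm y \<le> 1 \<Longrightarrow> \<bar>h (y, 0) - w (x0 + y) t1\<bar> \<le> e"
    and h2: "\<And>y. \<bar>h (y, 0)\<bar> \<le> K + e"
    using heat_approximation[OF cw K[OF t1(1)] e(1), of b k] by blast
  \<comment> \<open>The approximation of \<open>w\<close> by \<open>h\<close> holds only initially
    and locally; on the rest of the boundary a crude bound for all times is enough, given by the
    maximum principle with \<open>C = 0\<close>.\<close>
  have hlow: "h (y, s) \<ge> - (K + e)" if "s \<ge> 0" for y s
    using max_principle[OF heat_minus[OF h] b k order_refl[of 0] _ that, of "K + e" y] h2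
    by (simp add: abs_le_iff)
  define h' where "h' p = h (p + (- x0, - t1))" for p
  have h': "h' \<in> heat b k" unfolding h'_def by (rule heat_shift[OF h])
  have h'eq: "h' (x, t) = h (x - x0, t - t1)" for x t by (simp add: h'_def)
  \<comment> \<open>The slope \<open>c0\<close> absorbs the error in the equation for
    \<open>w\<close>, and the additional \<open>e\<close> makes the inequality strict.\<close>
  define H where "H p = h' p + ((e + (c0 + e) * (snd p - t1)) + C * bar2 x0 t1 p)" for p
  have sH: "smooth H" unfolding H_def
    by (intro smooth_add heat_smooth[OF h'] smooth_time smooth_cmult smooth_bar2)
  have barshift: "bar2 x0 t1 (x, t) = bar2 0 0 (x - x0, t - t1)" for x t
    by (simp add: bar2_def bar_def nsq_def)
  have "w x0 t0 \<le> H (x0, t0)"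
  proof (rule ccontr)
    assume neg: "\<not> ?thesis"
    let ?G = "\<lambda>(x, t). w x t - H (x, t)"
    \<comment> \<open>The cylinder reaches beyond \<open>t0\<close>: at height \<open>r^2\<close>
      the barrier is as large as on the lateral side. The maximum is thus interior in time as well,
      as the two-sided notion of local maximum demands.\<close>
    let ?S = "cball x0 r \<times> {t1..t1 + r\<^sup>2}"
    have "compact ?S" by (intro compact_Times compact_cball compact_Icc)
    moreover have in0: "(x0, t0) \<in> ?S" using r t1 by simp
    moreover have "continuous_on ?S (\<lambda>p. (\<lambda>(x, t). w x t) p - H p)"
      by (intro continuous_on_diff continuous_on_smooth[OF sH] continuous_on_subset[OF cont])
         (use t1 in auto)
    then have "continuous_on ?S ?G" by (simp add: case_prod_unfold)
    ultimately obtain z where z: "z \<in> ?S" "\<And>y. y \<in> ?S \<Longrightarrow> ?G y \<le> ?G z"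
      using continuous_attains_sup[of ?S ?G] by blast
    obtain x t where [simp]: "z = (x, t)" by (cases z)
    have Gz: "w x t > H (x, t)" using z(2)[OF in0] neg by simp
    have xt: "dist x x0 \<le> r" "t1 \<le> t" "t \<le> t1 + r\<^sup>2" using z(1) by (auto simp: dist_commute)
    have "t \<noteq> t1"
    proof
      assume [simp]: "t = t1"
      have "\<bar>h (x - x0, 0) - w x t1\<bar> \<le> e" using h1[of "x - x0"] xt r by (simp add: dist_norm)
      moreover have "C * bar2 x0 t1 (x, t) \<ge> 0" by (intro mult_nonneg_nonneg C bar2_nonneg)
      ultimately show False using Gz by (simp add: H_def h'eq)
    qed
    then have tpos: "t > t1" using xt by simp
    have inner: "dist x x0 < r \<and> t < t1 + r\<^sup>2"
    proof (rule ccontr)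
      assume "\<not> ?thesis"
      then have "dist x x0 = r \<or> t = t1 + r\<^sup>2" using xt by auto
      then have "bar x0 t1 (x, t) \<ge> r\<^sup>2"
      proof
        assume "dist x x0 = r"
        then show ?thesis using xt by (simp add: bar_def nsq_def dist_norm)
      next
        assume "t = t1 + r\<^sup>2"
        moreover have "r\<^sup>2 * 1 \<le> r\<^sup>2 * (4 * real CARD('n) + 8)" by (intro mult_left_mono) auto
        ultimately show ?thesis by (simp add: bar_def nsq_def mult.commute add_increasing)
      qed
      then have "r\<^sup>2 * r\<^sup>2 \<le> bar2 x0 t1 (x, t)" unfolding bar2_def
        by (intro mult_mono) (auto intro: order_trans[OF zero_le_power2])
      then have "C * r ^ 4 \<le> C * bar2 x0 t1 (x, t)" using C
        by (intro mult_left_mono) (auto simp: power4_eq_xxxx power2_eq_square mult.assoc)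
      moreover have "h' (x, t) \<ge> - (K + e)" using hlow[of "t - t1" "x - x0"] xt by (simp add: h'eq)
      moreover have "(c0 + e) * (t - t1) \<ge> 0" using c0 e xt by simp
      moreover have "w x t \<le> K" using K[of t x] xt t1 by simp
      ultimately show False using Gz C e by (simp add: H_def)
    qed
    have "local_max_at (\<lambda>(x, t). w x t - H (x, t)) (x, t)"
    proof -
      have "open (ball x0 r \<times> {t1<..<t1 + r\<^sup>2})" by (intro open_Times open_ball open_greaterThanLessThan)
      moreover have "(x, t) \<in> ball x0 r \<times> {t1<..<t1 + r\<^sup>2}" using inner tpos by (simp add: dist_commute)
      ultimately show ?thesis
      proof (rule local_max_atI)
        fix p assume "p \<in> ball x0 r \<times> {t1<..<t1 + r\<^sup>2}"
        then have "p \<in> ?S" by auto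
        from z(2)[OF this] show "?G p \<le> ?G (x, t)" by simp
      qed
    qed
    from test[OF sH _ _ this] have "Dt H (x, t) \<le> Lin b k H (x, t) + c0"
      using inner tpos t1 \<open>r\<^sup>2 \<le> r\<close> by auto
    moreover have "Dt H (x, t) = Dt h' (x, t) + (c0 + e) + C * Dt (bar2 x0 t1) (x, t)"
      unfolding H_def by (simp only: Dt_add Dt_cmult heat_smooth[OF h'] smooth_time smooth_add
          smooth_cmult smooth_bar2 Dt_time; simp)
    moreover have "Lin b k H (x, t) = Lin b k h' (x, t) + C * Lin b k (bar2 x0 t1) (x, t)"
      unfolding H_def by (simp only: Lin_add Lin_cmult heat_smooth[OF h'] smooth_time smooth_add
          smooth_cmult smooth_bar2 Lin_time; simp)
    moreover have "C * Lin b k (bar2 x0 t1) (x, t) \<le> C * Dt (bar2 x0 t1) (x, t)"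
      using bar2_supersolution[of t1 "(x, t)" k b x0] xt k C by (intro mult_left_mono) auto
    ultimately show False using heat_equation[OF h', of "(x, t)"] e by simp
  qed
  then have "w x0 t0 \<le> h (0, \<tau>) + e + (c0 + e) * \<tau> + C * bar2 0 0 (0 :: real^'n, \<tau>)"
    using barshift[of x0 t0] by (simp add: H_def h'eq t1_def)
  with h h1 h2 show ?thesis unfolding t1_def by blast
qed

subsection \<open>Sup-convolution in space\<close>

definition sconv :: "real \<Rightarrow> (real^'n::finite \<Rightarrow> real \<Rightarrow> real) \<Rightarrow> real^'n \<Rightarrow> real \<Rightarrow> real" where
  "sconv N u x t = (SUP y. u y t - N * (norm (y - x))\<^sup>2)"

lemma Dx_shift: "smooth f \<Longrightarrow> Dx i (\<lambda>p. f (p + a)) = (\<lambda>p. Dx i f (p + a))"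
  by (simp add: Dx_def dirD_shift)

lemma grad_x_shift: "smooth f \<Longrightarrow> grad_x (\<lambda>p. f (p + a)) p = grad_x f (p + a)"
  by (simp add: grad_x_def Dx_shift)

lemma mcf_op_shift: "smooth f \<Longrightarrow> mcf_op \<eta> (\<lambda>p. f (p + a)) p = mcf_op \<eta> f (p + a)"
proof -
  assume f: "smooth f"
  then have "smooth (Dx j f)" for j by (simp add: Dx_def smooth_dirD)
  with f show ?thesis by (simp add: mcf_op_def Dx_shift)
qed

locale bounded_continuous =
  fixes u :: "real^'n::finite \<Rightarrow> real \<Rightarrow> real" and K N :: real
  assumes cont: "continuous_on (UNIV \<times> {0..}) (\<lambda>(x, t). u x t)"
    and bound: "\<And>x t. t \<ge> 0 \<Longrightarrow> \<bar>u x t\<bar> \<le> K"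
    and N: "N > 0"
begin

lemma K_nonneg: "K \<ge> 0"
  using bound[of 0 0] by simp

lemma sconv_upper:
  assumes "t \<ge> 0"
  shows "u y t - N * (norm (y - x))\<^sup>2 \<le> sconv N u x t"
  unfolding sconv_def
proof (rule cSUP_upper)
  show "bdd_above (range (\<lambda>y. u y t - N * (norm (y - x))\<^sup>2))"
  proof (rule bdd_aboveI2)
    show "u y t - N * (norm (y - x))\<^sup>2 \<le> K" for y
      using bound[OF assms, of y] N by (smt (verit) mult_nonneg_nonneg zero_le_power2)
  qed
qed simp

text \<open>Written in the offset from \<open>x\<close> rather than the point itself, so that the
  maximizers for all \<open>x\<close> lie in one compact ball and continuity is uniform over
  it.\<close>

lemma continuous_on_penalized:
  "continuous_on ((UNIV \<times> {0..}) \<times> C) (\<lambda>((x, t), \<zeta>). u (x + \<zeta>) t - N * (norm \<zeta>)\<^sup>2)"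
proof -
  have "continuous_on ((UNIV \<times> {0..}) \<times> C)
      (\<lambda>q. (\<lambda>(x, t). u x t) (fst (fst q) + snd q, snd (fst q)) - N * (norm (snd q))\<^sup>2)"
    by (intro continuous_on_diff continuous_on_compose2[OF cont] continuous_on_Pair
        continuous_on_add continuous_on_mult continuous_on_power continuous_on_norm
        continuous_on_fst continuous_on_snd continuous_on_id continuous_on_const) auto
  then show ?thesis by (simp add: case_prod_unfold)
qed

lemma sconv_attained:
  assumes "t \<ge> 0"
  shows "\<exists>y. sconv N u x t = u y t - N * (norm (y - x))\<^sup>2"
proof -
  \<comment> \<open>Beyond this radius the penalty exceeds \<open>2 * K\<close>, the most that
    \<open>u\<close> can gain, so the centre does at least as well.\<close>
  define R where "R = sqrt (2 * K / N)"
  let ?f = "\<lambda>\<zeta>. u (x + \<zeta>) t - N * (norm \<zeta>)\<^sup>2"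
  have R: "R \<ge> 0" "N * R\<^sup>2 = 2 * K" using K_nonneg N by (auto simp: R_def)
  have "continuous_on (cball 0 R)
      (\<lambda>\<zeta>. (\<lambda>((x, t), \<zeta>). u (x + \<zeta>) t - N * (norm \<zeta>)\<^sup>2) ((x, t), \<zeta>))"
    by (rule continuous_on_compose2[OF continuous_on_penalized[of UNIV]])
       (use assms in \<open>auto intro!: continuous_intros\<close>)
  then have "continuous_on (cball 0 R) ?f" by simp
  then obtain z where z: "z \<in> cball 0 R" "\<And>y. y \<in> cball 0 R \<Longrightarrow> ?f y \<le> ?f z"
    using continuous_attains_sup[of "cball 0 R" ?f] R by (auto simp: compact_cball)
  have "?f y \<le> ?f z" for y
  proof (cases "norm y \<le> R")
    case False
    then have "R\<^sup>2 \<le> (norm y)\<^sup>2" using R by (intro power_mono) auto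
    then have "2 * K \<le> N * (norm y)\<^sup>2" using N R(2) by (metis mult_left_mono less_imp_le)
    then have "?f y \<le> ?f 0" using bound[OF assms, of "x + y"] bound[OF assms, of x] by simp
    also have "\<dots> \<le> ?f z" using z(2)[of 0] R by simp
    finally show ?thesis .
  qed (use z(2) in simp)
  then have "sconv N u x t \<le> ?f z"
    unfolding sconv_def by (intro cSUP_least) (auto, metis add_diff_cancel_left' diff_add_cancel)
  moreover have "?f z \<le> sconv N u x t" using sconv_upper[OF assms, of "x + z" x] by simp
  ultimately show ?thesis by (intro exI[of _ "x + z"]) simp
qed

lemma sconv_ge: "t \<ge> 0 \<Longrightarrow> u x t \<le> sconv N u x t"
  using sconv_upper[of t x x] by simp

lemma sconv_bound:
  assumes "t \<ge> 0"
  shows "\<bar>sconv N u x t\<bar> \<le> K"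
proof -
  obtain y where y: "sconv N u x t = u y t - N * (norm (y - x))\<^sup>2" using sconv_attained[OF assms] by blast
  have "N * (norm (y - x))\<^sup>2 \<ge> 0" using N by simp
  then have "sconv N u x t \<le> K" using y bound[OF assms, of y] by simp
  moreover have "sconv N u x t \<ge> - K" using sconv_ge[OF assms, of x] bound[OF assms, of x] by simp
  ultimately show ?thesis by simp
qed

lemma maximizer_close:
  assumes "t \<ge> 0" "sconv N u x t = u y t - N * (norm (y - x))\<^sup>2"
  shows "norm (y - x) \<le> sqrt (2 * K / N)"
proof -
  have "N * (norm (y - x))\<^sup>2 \<le> 2 * K"
    using assms(2) sconv_bound[OF assms(1), of x] bound[OF assms(1), of y] by simp
  then have "(norm (y - x))\<^sup>2 \<le> 2 * K / N" using N by (simp add: field_simps)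
  then show ?thesis by (simp add: real_le_rsqrt)
qed

text \<open>The penalized values vary little, uniformly in the offset, when the point moves; the
  optimal offset at one point is then nearly optimal at the other.\<close>

lemma continuous_on_sconv: "continuous_on (UNIV \<times> {0..}) (\<lambda>(x, t). sconv N u x t)"
  unfolding continuous_on_iff
proof (intro ballI allI impI)
  fix p :: "(real^'n) \<times> real" and e :: real
  assume p: "p \<in> UNIV \<times> {0..}" and "e > 0"
  define R where "R = sqrt (2 * K / N)"
  let ?f = "\<lambda>((x, t), \<zeta>). u (x + \<zeta>) t - N * (norm \<zeta>)\<^sup>2"
  obtain X where X: "p \<in> X" "open X"
    "\<forall>q\<in>X \<inter> (UNIV \<times> {0..}). \<forall>\<zeta>\<in>cball 0 R. dist (?f (q, \<zeta>)) (?f (p, \<zeta>)) \<le> e / 2"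
    using continuous_on_prod_compactE[OF continuous_on_penalized compact_cball p, of "e / 2" 0 R] \<open>e > 0\<close>
    by auto
  have le: "sconv N u x t \<le> sconv N u x' t' + e / 2"
    if t: "t \<ge> 0" "t' \<ge> 0"
      and d: "\<And>\<zeta>. \<zeta> \<in> cball 0 R \<Longrightarrow> ?f ((x, t), \<zeta>) \<le> ?f ((x', t'), \<zeta>) + e / 2" for x t x' t'
  proof -
    obtain y where y: "sconv N u x t = u y t - N * (norm (y - x))\<^sup>2" using sconv_attained[OF t(1)] by blast
    have "y - x \<in> cball 0 R" using maximizer_close[OF t(1) y] by (simp add: R_def)
    from d[OF this] y show ?thesis using sconv_upper[OF t(2), of "x' + (y - x)" x'] by simp
  qed
  obtain d where d: "d > 0" "ball p d \<subseteq> X" using X open_contains_ball by metis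
  show "\<exists>d>0. \<forall>q\<in>UNIV \<times> {0..}. dist q p < d \<longrightarrow>
      dist ((\<lambda>(x, t). sconv N u x t) q) ((\<lambda>(x, t). sconv N u x t) p) < e"
  proof (intro exI[of _ d] conjI ballI impI)
    fix q assume q: "q \<in> UNIV \<times> {0..}" "dist q p < d"
    then have "q \<in> X" using d by (auto simp: dist_commute subset_eq)
    with X(3) q have close: "\<And>\<zeta>. \<zeta> \<in> cball 0 R \<Longrightarrow> \<bar>?f (q, \<zeta>) - ?f (p, \<zeta>)\<bar> \<le> e / 2"
      by (auto simp: dist_real_def)
    obtain x t x' t' where [simp]: "q = (x, t)" "p = (x', t')" by (cases q, cases p)
    have close': "?f ((x, t), \<zeta>) \<le> ?f ((x', t'), \<zeta>) + e / 2"
      "?f ((x', t'), \<zeta>) \<le> ?f ((x, t), \<zeta>) + e / 2" if "\<zeta> \<in> cball 0 R" for \<zeta>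
      using close[OF that, THEN abs_le_D1] close[OF that, THEN abs_le_D2] by simp_all
    have "sconv N u x t \<le> sconv N u x' t' + e / 2"
      by (rule le[OF _ _ close'(1)]) (use p q in auto)
    moreover have "sconv N u x' t' \<le> sconv N u x t + e / 2"
      by (rule le[OF _ _ close'(2)]) (use p q in auto)
    ultimately show "dist ((\<lambda>(x, t). sconv N u x t) q) ((\<lambda>(x, t). sconv N u x t) p) < e"
      using \<open>e > 0\<close> by (simp add: dist_real_def abs_less_iff)
  qed (use d in simp)
qed

text \<open>With the maximizer \<open>y\<close> held fixed, a downward paraboloid lies below the
  sup-convolution and meets it at \<open>x\<close>, hence also meets \<open>\<psi>\<close> from
  below up to a constant. For the third claim \<open>x\<close> and \<open>y\<close> move in
  parallel, which keeps the penalty unchanged.\<close>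

lemma sconv_touching:
  assumes \<psi>: "smooth \<psi>" and t: "t > 0"
    and max: "local_max_at (\<lambda>(x, t). sconv N u x t - \<psi> (x, t)) (x, t)"
    and y: "sconv N u x t = u y t - N * (norm (y - x))\<^sup>2"
  shows "grad_x \<psi> (x, t) = (2 * N) *\<^sub>R (y - x)"
    and "D2 v v \<psi> (x, t) \<ge> - 2 * N * (norm v)\<^sup>2"
    and "local_max_at (\<lambda>(x', t). u x' t - \<psi> ((x', t) + (x - y, 0))) (y, t)"
proof -
  obtain e where e: "e > 0" and e': "\<And>x' t'. t' \<ge> 0 \<Longrightarrow> dist (x', t') (x, t) < e \<Longrightarrow>
      sconv N u x' t' - \<psi> (x', t') \<le> sconv N u x t - \<psi> (x, t)"
    using max unfolding local_max_at_def by auto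
  have low: "\<psi> (x, t) + ((2 * N) *\<^sub>R (y - x)) \<bullet> v - N * (norm v)\<^sup>2 \<le> \<psi> (x + v, t)"
    if "norm v < e" for v
  proof -
    have expand: "(norm (y - (x + v)))\<^sup>2 = (norm (y - x))\<^sup>2 - 2 * ((y - x) \<bullet> v) + (norm v)\<^sup>2"
      unfolding power2_norm_eq_inner by (simp add: inner_diff inner_add inner_commute)
    have "sconv N u (x + v) t - \<psi> (x + v, t) \<le> sconv N u x t - \<psi> (x, t)"
      using that t by (intro e') (auto simp: dist_norm)
    moreover have "u y t - N * (norm (y - (x + v)))\<^sup>2 \<le> sconv N u (x + v) t"
      using t by (intro sconv_upper) simp
    moreover have "N * (norm (y - (x + v)))\<^sup>2 = N * (norm (y - x))\<^sup>2 - 2 * N * ((y - x) \<bullet> v) + N * (norm v)\<^sup>2"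
      unfolding expand by (simp only: distrib_left right_diff_distrib mult.assoc mult.left_commute)
    ultimately show ?thesis using y unfolding inner_scaleR_left by linarith
  qed
  show "grad_x \<psi> (x, t) = (2 * N) *\<^sub>R (y - x)" "D2 v v \<psi> (x, t) \<ge> - 2 * N * (norm v)\<^sup>2"
    using touching_below_quadratic[OF \<psi> e low] by auto
  show "local_max_at (\<lambda>(x', t). u x' t - \<psi> ((x', t) + (x - y, 0))) (y, t)"
    unfolding local_max_at_def
  proof (intro exI[of _ e] conjI allI impI)
    fix p :: "(real^'n) \<times> real" assume p: "snd p \<ge> 0" "dist p (y, t) < e"
    obtain x' t' where [simp]: "p = (x', t')" by (cases p)
    have "dist (x' + (x - y), t') (x, t) < e" using p by (simp add: dist_Pair_Pair dist_norm algebra_simps)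
    then have "sconv N u (x' + (x - y)) t' - \<psi> (x' + (x - y), t') \<le> sconv N u x t - \<psi> (x, t)"
      using p by (intro e') auto
    moreover have "u x' t' - N * (norm (x' - (x' + (x - y))))\<^sup>2 \<le> sconv N u (x' + (x - y)) t'"
      using p by (intro sconv_upper) simp
    ultimately show "(case p of (x', t) \<Rightarrow> u x' t - \<psi> ((x', t) + (x - y, 0)))
        \<le> (case (y, t) of (x', t) \<Rightarrow> u x' t - \<psi> ((x', t) + (x - y, 0)))"
      using y by (simp add: norm_minus_commute)
  qed (rule e)
qed

text \<open>The equation is invariant under translation, so the inequality at the maximizer for the
  shifted test function is the one wanted at \<open>x\<close>.\<close>

lemma sconv_subsolution:
  assumes sub: "mcf_visc_sub u" and \<psi>: "smooth \<psi>" and t: "t > 0"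
    and max: "local_max_at (\<lambda>(x, t). sconv N u x t - \<psi> (x, t)) (x, t)"
  shows "grad_x \<psi> (x, t) \<noteq> 0 \<Longrightarrow> Dt \<psi> (x, t) \<le> mcf_op (sgn (grad_x \<psi> (x, t))) \<psi> (x, t)"
    and "grad_x \<psi> (x, t) = 0 \<Longrightarrow> \<exists>\<eta>. norm \<eta> \<le> 1 \<and> Dt \<psi> (x, t) \<le> mcf_op \<eta> \<psi> (x, t)"
proof -
  obtain y where y: "sconv N u x t = u y t - N * (norm (y - x))\<^sup>2"
    using sconv_attained[of t x] t by auto
  let ?\<psi> = "\<lambda>p. \<psi> (p + (x - y, 0))"
  have s: "smooth ?\<psi>" by (rule smooth_shift[OF \<psi>])
  have m: "local_max_at (\<lambda>(x, t). u x t - ?\<psi> (x, t)) (y, t)"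
    using sconv_touching(3)[OF \<psi> t max y] .
  have eq: "Dt ?\<psi> (y, t) = Dt \<psi> (x, t)" "grad_x ?\<psi> (y, t) = grad_x \<psi> (x, t)"
    "mcf_op \<eta> ?\<psi> (y, t) = mcf_op \<eta> \<psi> (x, t)" for \<eta>
    by (simp_all add: Dt_def dirD_shift[OF \<psi>] grad_x_shift[OF \<psi>] mcf_op_shift[OF \<psi>])
  have *: "(grad_x ?\<psi> (y, t) \<noteq> 0 \<longrightarrow>
          Dt ?\<psi> (y, t) \<le> mcf_op (grad_x ?\<psi> (y, t) /\<^sub>R norm (grad_x ?\<psi> (y, t))) ?\<psi> (y, t)) \<and>
       (grad_x ?\<psi> (y, t) = 0 \<longrightarrow>
          (\<exists>\<eta>. norm \<eta> \<le> 1 \<and> Dt ?\<psi> (y, t) \<le> mcf_op \<eta> ?\<psi> (y, t)))"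
    using sub s m t unfolding mcf_visc_sub_def by blast
  show "grad_x \<psi> (x, t) \<noteq> 0 \<Longrightarrow> Dt \<psi> (x, t) \<le> mcf_op (sgn (grad_x \<psi> (x, t))) \<psi> (x, t)"
    using * unfolding eq sgn_div_norm by blast
  show "grad_x \<psi> (x, t) = 0 \<Longrightarrow> \<exists>\<eta>. norm \<eta> \<le> 1 \<and> Dt \<psi> (x, t) \<le> mcf_op \<eta> \<psi> (x, t)"
    using * unfolding eq by blast
qed

text \<open>A smooth function touching the sup-convolution from above forces the maximizer to be
  unique, so by compactness the maximizers, and with them the gradients of all test functions at
  nearby points, depend continuously on the point.\<close>

lemma maximizer_continuous:
  assumes t0: "t0 > 0" and y0: "sconv N u x0 t0 = u y0 t0 - N * (norm (y0 - x0))\<^sup>2"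
    and \<phi>: "smooth \<phi>" and max: "local_max_at (\<lambda>(x, t). sconv N u x t - \<phi> (x, t)) (x0, t0)"
    and \<eta>: "\<eta> > 0"
  shows "\<exists>r>0. \<forall>x t y. t \<ge> 0 \<longrightarrow> dist x x0 < r \<longrightarrow> \<bar>t - t0\<bar> < r \<longrightarrow>
    sconv N u x t = u y t - N * (norm (y - x))\<^sup>2 \<longrightarrow> norm ((y - x) - (y0 - x0)) < \<eta>"
proof -
  define R where "R = sqrt (2 * K / N)"
  \<comment> \<open>The admissible offsets that are at least \<eta> away from the optimal
    one.\<close>
  define C where "C = cball 0 R - ball (y0 - x0) \<eta>"
  have C: "compact C" unfolding C_def by (intro compact_diff compact_cball open_ball)
  \<comment> \<open>The deficit of an offset: it vanishes exactly at maximizers. On \<open>C\<close>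
    it is bounded below at \<open>(x0, t0)\<close>, and this persists nearby.\<close>
  define f where "f = (\<lambda>q. (\<lambda>(x, t). sconv N u x t) (fst q) - (\<lambda>((x, t), \<zeta>). u (x + \<zeta>) t - N * (norm \<zeta>)\<^sup>2) q)"
  have fc: "continuous_on ((UNIV \<times> {0..}) \<times> C) f"
    unfolding f_def
    by (intro continuous_on_diff continuous_on_penalized continuous_on_compose2[OF continuous_on_sconv]
        continuous_on_fst continuous_on_id) auto
  have pos: "f ((x0, t0), \<zeta>) > 0" if "\<zeta> \<in> C" for \<zeta>
  proof (rule ccontr)
    assume "\<not> ?thesis"
    then have "sconv N u x0 t0 = u (x0 + \<zeta>) t0 - N * (norm ((x0 + \<zeta>) - x0))\<^sup>2"
      using sconv_upper[of t0 "x0 + \<zeta>" x0] t0 by (simp add: f_def)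
    from sconv_touching(1)[OF \<phi> t0 max this] sconv_touching(1)[OF \<phi> t0 max y0]
    have "\<zeta> = y0 - x0" using N by simp
    with that \<eta> show False by (simp add: C_def)
  qed
  obtain \<delta> where \<delta>: "\<delta> > 0" "\<And>\<zeta>. \<zeta> \<in> C \<Longrightarrow> f ((x0, t0), \<zeta>) \<ge> \<delta>"
  proof (cases "C = {}")
    case False
    have "continuous_on C (\<lambda>\<zeta>. f ((x0, t0), \<zeta>))"
      by (rule continuous_on_compose2[OF fc]) (use t0 in \<open>auto intro!: continuous_intros\<close>)
    then obtain z where "z \<in> C" "\<And>\<zeta>. \<zeta> \<in> C \<Longrightarrow> f ((x0, t0), z) \<le> f ((x0, t0), \<zeta>)"
      using continuous_attains_inf[OF C False] by blast
    with pos that show ?thesis by blast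
  qed (use that[of 1] in auto)
  have p0: "(x0, t0) \<in> UNIV \<times> {0..}" using t0 by simp
  obtain X where X: "(x0, t0) \<in> X" "open X"
    "\<forall>q\<in>X \<inter> (UNIV \<times> {0..}). \<forall>\<zeta>\<in>C. dist (f (q, \<zeta>)) (f ((x0, t0), \<zeta>)) \<le> \<delta> / 2"
    using continuous_on_prod_compactE[OF fc C p0, of "\<delta> / 2"] \<delta> by auto
  obtain A B where AB: "open A" "open B" "(x0, t0) \<in> A \<times> B" "A \<times> B \<subseteq> X"
    by (rule open_prod_elim[OF X(2) X(1)])
  obtain r1 r2 where r: "r1 > 0" "ball x0 r1 \<subseteq> A" "r2 > 0" "ball t0 r2 \<subseteq> B"
    using AB open_contains_ball by (metis mem_Sigma_iff)
  show ?thesis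
  proof (intro exI[of _ "min r1 r2"] conjI allI impI)
    fix x t y
    assume t: "t \<ge> 0" and "dist x x0 < min r1 r2" "\<bar>t - t0\<bar> < min r1 r2"
      and y: "sconv N u x t = u y t - N * (norm (y - x))\<^sup>2"
    then have "(x, t) \<in> A \<times> B" using r by (auto simp: subset_eq dist_commute dist_real_def)
    then have inX: "(x, t) \<in> X \<inter> (UNIV \<times> {0..})" using AB t by auto
    show "norm ((y - x) - (y0 - x0)) < \<eta>"
    proof (rule ccontr)
      assume "\<not> ?thesis"
      then have "y - x \<in> C" using maximizer_close[OF t y]
        by (simp add: C_def R_def dist_norm norm_minus_commute)
      with X(3) inX have "dist (f ((x, t), y - x)) (f ((x0, t0), y - x)) \<le> \<delta> / 2" by blast
      moreover have "f ((x, t), y - x) = 0" using y by (simp add: f_def)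
      ultimately show False using \<delta>(1) \<delta>(2)[OF \<open>y - x \<in> C\<close>] by (simp add: dist_real_def)
    qed
  qed (use r in simp)
qed

text \<open>The radius does not depend on \<open>\<psi>\<close>: whatever test function touches at a
  nearby point, its gradient is \<open>2 * N\<close> times the offset of the maximizer there, and
  that offset is controlled by \<open>maximizer_continuous\<close>.\<close>

lemma sconv_frozen_equation:
  assumes sub: "mcf_visc_sub u"
    and t0: "t0 > 0" and \<phi>: "smooth \<phi>"
    and max: "local_max_at (\<lambda>(x, t). sconv N u x t - \<phi> (x, t)) (x0, t0)"
    and p0: "grad_x \<phi> (x0, t0) \<noteq> 0" and k: "k > 0"
  shows "\<exists>r>0. \<forall>\<psi> x t. smooth \<psi> \<longrightarrow> dist x x0 < r \<longrightarrow> \<bar>t - t0\<bar> < r \<longrightarrow>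
    local_max_at (\<lambda>(x, t). sconv N u x t - \<psi> (x, t)) (x, t) \<longrightarrow>
    Dt \<psi> (x, t) \<le> Lin (sgn (grad_x \<phi> (x0, t0))) k \<psi> (x, t) + 2 * N * real CARD('n) * k"
proof -
  obtain y0 where y0: "sconv N u x0 t0 = u y0 t0 - N * (norm (y0 - x0))\<^sup>2"
    using sconv_attained[of t0 x0] t0 by auto
  have g0: "grad_x \<phi> (x0, t0) = (2 * N) *\<^sub>R (y0 - x0)"
    by (rule sconv_touching(1)[OF \<phi> t0 max y0])
  then have nz: "y0 - x0 \<noteq> 0" using p0 by auto
  define b where "b = sgn (y0 - x0)"
  have b: "sgn (grad_x \<phi> (x0, t0)) = b"
    unfolding g0 b_def using N by (simp add: sgn_scaleR)
  have nb: "norm b = 1" using nz by (simp add: b_def norm_sgn)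
  \<comment> \<open>The distance of unit vectors at which the smallness hypothesis of
    \<open>Lap_D2_perturb\<close> holds with equality.\<close>
  define s where "s = sqrt (k / 2 / (1 + 2 / k))"
  have s: "s > 0" "(1 + 2 / k) * s\<^sup>2 = k / 2"
  proof -
    have "k / 2 / (1 + 2 / k) > 0" using k by (intro divide_pos_pos add_pos_pos) auto
    then show "s > 0" by (simp add: s_def)
    have "s\<^sup>2 = k / 2 / (1 + 2 / k)" using \<open>k / 2 / (1 + 2 / k) > 0\<close> by (simp add: s_def)
    moreover have "1 + 2 / k \<noteq> 0" using k by (smt (verit) divide_pos_pos)
    moreover have "c * (a / c) = a" if "c \<noteq> 0" for a c :: real using that by simp
    ultimately show "(1 + 2 / k) * s\<^sup>2 = k / 2" by metis
  qed
  have "(sgn \<longlongrightarrow> b) (at (y0 - x0))"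
    unfolding b_def by (rule tendsto_sgn[OF tendsto_ident_at nz])
  then obtain \<eta>1 where \<eta>1: "\<eta>1 > 0"
    "\<And>z. z \<noteq> y0 - x0 \<Longrightarrow> dist z (y0 - x0) < \<eta>1 \<Longrightarrow> dist (sgn z) b < s"
    using s(1) unfolding tendsto_iff eventually_at by blast
  \<comment> \<open>The second bound keeps the nearby offsets, and so the gradients, away from
    zero.\<close>
  define \<eta> where "\<eta> = min \<eta>1 (norm (y0 - x0))"
  have "\<eta> > 0" using \<eta>1 nz by (simp add: \<eta>_def)
  from maximizer_continuous[OF t0 y0 \<phi> max this] obtain r where r: "r > 0"
    "\<And>x t y. t \<ge> 0 \<Longrightarrow> dist x x0 < r \<Longrightarrow> \<bar>t - t0\<bar> < r \<Longrightarrow>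
      sconv N u x t = u y t - N * (norm (y - x))\<^sup>2 \<Longrightarrow> norm ((y - x) - (y0 - x0)) < \<eta>" by blast
  show ?thesis unfolding b
  proof (intro exI[of _ "min r t0"] conjI allI impI)
    fix \<psi> x t
    assume \<psi>: "smooth \<psi>" and x: "dist x x0 < min r t0" and t: "\<bar>t - t0\<bar> < min r t0"
      and m: "local_max_at (\<lambda>(x, t). sconv N u x t - \<psi> (x, t)) (x, t)"
    have tpos: "t > 0" using t by (auto simp: abs_less_iff)
    obtain y where y: "sconv N u x t = u y t - N * (norm (y - x))\<^sup>2"
      using sconv_attained[of t x] tpos by auto
    have close: "norm ((y - x) - (y0 - x0)) < \<eta>" using r(2)[OF _ _ _ y] tpos x t by auto
    define z where "z = y - x"
    have "z \<noteq> 0" using close by (auto simp: \<eta>_def z_def norm_minus_commute)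
    have g: "grad_x \<psi> (x, t) = (2 * N) *\<^sub>R z"
      unfolding z_def by (rule sconv_touching(1)[OF \<psi> tpos m y])
    have "dist (sgn z) b < s"
    proof (cases "z = y0 - x0")
      case False
      then show ?thesis using close by (intro \<eta>1) (auto simp: dist_norm z_def \<eta>_def)
    qed (use s in \<open>simp add: b_def\<close>)
    then have "(norm (b - sgn z))\<^sup>2 \<le> s\<^sup>2"
      by (intro power_mono) (auto simp: dist_norm norm_minus_commute)
    then have "(1 + 2 / k) * (norm (b - sgn z))\<^sup>2 \<le> (1 + 2 / k) * s\<^sup>2"
      using k by (intro mult_left_mono) auto
    then have ab: "(1 + 2 / k) * (norm (b - sgn z))\<^sup>2 \<le> k / 2" using s by simp
    have "grad_x \<psi> (x, t) \<noteq> 0" using g N \<open>z \<noteq> 0\<close> by simp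
    from sconv_subsolution(1)[OF sub \<psi> tpos m this]
    have "Dt \<psi> (x, t) \<le> mcf_op (sgn z) \<psi> (x, t)"
      unfolding g using N by (simp add: sgn_scaleR)
    also have "\<dots> = Lap \<psi> (x, t) - D2 (sgn z) (sgn z) \<psi> (x, t)" by (rule mcf_op_eq[OF \<psi>])
    also have "\<dots> \<le> Lin b k \<psi> (x, t) + 2 * N * real CARD('n) * k"
      using sconv_touching(2)[OF \<psi> tpos m y] k nb ab \<open>z \<noteq> 0\<close>
      by (intro Lap_D2_perturb[OF \<psi>]) (auto simp: norm_sgn)
    finally show "Dt \<psi> (x, t) \<le> Lin b k \<psi> (x, t) + 2 * N * real CARD('n) * k" .
  qed (use r t0 in simp)
qed

end

subsection \<open>Doubling of variables\<close>

text \<open>The doubled penalty as a function of one point, the other being frozen at space point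
  \<open>a\<close> (after the shift by \<open>z\<close>) and time \<open>s0\<close>.\<close>

definition pen :: "real \<Rightarrow> real^'n::finite \<Rightarrow> real \<Rightarrow> real \<Rightarrow> (real^'n) \<times> real \<Rightarrow> real" where
  "pen N a l s0 p = N * (nsq a p * nsq a p) + ((0 + l * (snd p - 0)) +
     N * ((0 + 1 * (snd p - s0)) * (0 + 1 * (snd p - s0))))"

lemmas smooth_pen_intros = smooth_add smooth_mult smooth_cmult smooth_nsq smooth_time

lemma smooth_pen: "smooth (pen N a l s0)"
  unfolding pen_def by (intro smooth_pen_intros)

lemma dirD_pen:
  "dirD w (pen N a l s0) p = 4 * N * nsq a p * ((fst p - a) \<bullet> fst w) + l * snd w
     + 2 * N * (snd p - s0) * snd w"
  unfolding pen_def
  by (simp only: dirD_add dirD_cmult dirD_mult smooth_pen_intros dirD_nsq dirD_time) simp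

lemma Dt_pen: "Dt (pen N a l s0) p = l + 2 * N * (snd p - s0)"
  by (simp add: Dt_def dirD_pen)

lemma grad_x_pen: "grad_x (pen N a l s0) p = (4 * N * nsq a p) *\<^sub>R (fst p - a)"
  by (simp add: grad_x_def Dx_def dirD_pen vec_eq_iff inner_axis)

lemma D2_pen_center: "D2 v w (pen N a l s0) (a, t) = 0"
proof -
  let ?q = "\<lambda>p. N * (nsq a p * nsq a p)"
  have "D2 v w (pen N a l s0) (a, t) = D2 v w ?q (a, t) +
      N * D2 v w (\<lambda>p. (0 + 1 * (snd p - s0)) * (0 + 1 * (snd p - s0))) (a, t)"
    unfolding pen_def by (simp only: D2_add D2_cmult smooth_pen_intros D2_time; simp)
  also have "D2 v w ?q (a, t) = 0"
    by (simp only: D2_cmult D2_square smooth_pen_intros dirD_nsq) (simp add: nsq_def)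
  also have "D2 v w (\<lambda>p. (0 + 1 * (snd p - s0)) * (0 + 1 * (snd p - s0))) (a, t) = 0"
    by (simp only: D2_square smooth_pen_intros D2_time dirD_time) simp
  finally show ?thesis by simp
qed

text \<open>The two functions have opposite gradients at a doubled maximum; this is why they satisfy
  the same linear equation.\<close>

lemma Lin_minus_direction: "smooth f \<Longrightarrow> Lin (- b) k f p = Lin b k f p"
proof -
  assume f: "smooth f"
  have "D2 (- b) (- b) f p = D2 b b f p"
    using linear_neg[OF linear_D2_left[OF f, of "- b" p], of b]
      linear_neg[OF linear_D2_right[OF f, of b p], of b] by simp
  then show ?thesis by (simp add: Lin_def)
qed

text \<open>Here \<open>v\<close> stands for the negative of the second solution, so both functions
  are subsolutions and their sum is what is penalized.\<close>

lemma doubling_contradiction: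
  fixes u v :: "real^'n::finite \<Rightarrow> real \<Rightarrow> real"
  assumes bcu: "bounded_continuous u K N" and bcv: "bounded_continuous v K N"
    and subu: "mcf_visc_sub u" and subv: "mcf_visc_sub v"
    and t1: "0 \<le> t1" "t1 < t0" "t1 < s0" and l: "l > 0"
    and max: "\<And>x y t s. t1 \<le> t \<Longrightarrow> t1 \<le> s \<Longrightarrow>
      sconv N u x t + sconv N v y s - N * ((norm (x - y - z))\<^sup>2)\<^sup>2 - N * (t - s)\<^sup>2 - l * t
      \<le> sconv N u x0 t0 + sconv N v y0 s0 - N * ((norm (x0 - y0 - z))\<^sup>2)\<^sup>2 - N * (t0 - s0)\<^sup>2 - l * t0"
  shows False
proof -
  interpret u: bounded_continuous u K N by (rule bcu)
  interpret v: bounded_continuous v K N by (rule bcv)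
  let ?U = "sconv N u" and ?V = "sconv N v"
  define \<phi> where "\<phi> = pen N (y0 + z) l s0"
  define \<psi> where "\<psi> = pen N (x0 - z) 0 t0"
  have sm: "smooth \<phi>" "smooth \<psi>" by (simp_all add: \<phi>_def \<psi>_def smooth_pen)
  have maxu: "local_max_at (\<lambda>(x, t). ?U x t - \<phi> (x, t)) (x0, t0)"
  proof (rule local_max_atI[of "UNIV \<times> {t1<..}"])
    fix p :: "(real^'n) \<times> real" assume p: "p \<in> UNIV \<times> {t1<..}"
    obtain x t where [simp]: "p = (x, t)" by (cases p)
    show "(case p of (x, t) \<Rightarrow> ?U x t - \<phi> (x, t)) \<le> (case (x0, t0) of (x, t) \<Rightarrow> ?U x t - \<phi> (x, t))"
      using max[of t s0 x y0] p t1
      by (simp add: \<phi>_def pen_def nsq_def power2_eq_square diff_diff_eq)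
  qed (use t1 in \<open>auto intro: open_Times\<close>)
  have maxv: "local_max_at (\<lambda>(x, t). ?V x t - \<psi> (x, t)) (y0, s0)"
  proof (rule local_max_atI[of "UNIV \<times> {t1<..}"])
    fix p :: "(real^'n) \<times> real" assume p: "p \<in> UNIV \<times> {t1<..}"
    obtain y s where [simp]: "p = (y, s)" by (cases p)
    have n: "norm (x0 - y - z) = norm (y - (x0 - z))" for y
      by (subst norm_minus_commute) (simp add: algebra_simps)
    have s: "(t0 - s)\<^sup>2 = (s - t0)\<^sup>2" for s by (rule power2_commute)
    show "(case p of (x, t) \<Rightarrow> ?V x t - \<psi> (x, t)) \<le> (case (y0, s0) of (x, t) \<Rightarrow> ?V x t - \<psi> (x, t))"
      using max[of t0 s x0 y] p t1 unfolding n s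
      by (simp add: \<psi>_def pen_def nsq_def power2_eq_square)
  qed (use t1 in \<open>auto intro: open_Times\<close>)
  have tpos: "t0 > 0" "s0 > 0" using t1 by auto
  define d where "d = x0 - y0 - z"
  have gu: "grad_x \<phi> (x0, t0) = (4 * N * (norm d)\<^sup>2) *\<^sub>R d"
    by (simp add: \<phi>_def grad_x_pen nsq_def d_def diff_diff_eq)
  have nd: "y0 - (x0 - z) = - d" by (simp add: d_def)
  have gv: "grad_x \<psi> (y0, s0) = (4 * N * (norm d)\<^sup>2) *\<^sub>R (- d)"
    by (simp add: \<psi>_def grad_x_pen nsq_def nd)
  have N: "N > 0" by (rule u.N)
  show False
  proof (cases "d = 0")
    case True
    then have eq: "x0 = y0 + z" "y0 = x0 - z" by (simp_all add: d_def algebra_simps)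
    have "D2 v w \<phi> (x0, t0) = 0" for v w
      unfolding \<phi>_def by (subst eq(1)) (simp add: D2_pen_center)
    then have "mcf_op \<eta> \<phi> (x0, t0) = 0" for \<eta>
      by (simp add: mcf_op_eq[OF sm(1)] Lap_def)
    moreover have "grad_x \<phi> (x0, t0) = 0" using gu True by simp
    ultimately have 1: "l + 2 * N * (t0 - s0) \<le> 0"
      using u.sconv_subsolution(2)[OF subu sm(1) tpos(1) maxu] by (auto simp: \<phi>_def Dt_pen)
    have "D2 v w \<psi> (y0, s0) = 0" for v w
      unfolding \<psi>_def by (subst eq(2)) (simp add: D2_pen_center)
    then have "mcf_op \<eta> \<psi> (y0, s0) = 0" for \<eta>
      by (simp add: mcf_op_eq[OF sm(2)] Lap_def)
    moreover have "grad_x \<psi> (y0, s0) = 0" using gv True by simp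
    ultimately have "0 + 2 * N * (s0 - t0) \<le> 0"
      using v.sconv_subsolution(2)[OF subv sm(2) tpos(2) maxv] by (auto simp: \<psi>_def Dt_pen)
    \<comment> \<open>The time penalty contributes opposite slopes to the two inequalities, so their
      sum leaves \<open>l \<le> 0\<close>.\<close>
    with 1 l show False by (simp add: algebra_simps)
  next
    case False
    define b where "b = sgn d"
    have b: "norm b = 1" using False by (simp add: b_def norm_sgn)
    have pos: "4 * N * (norm d)\<^sup>2 > 0" using N False by simp
    have N0: "N \<noteq> 0" using N by simp
    have gu': "grad_x \<phi> (x0, t0) \<noteq> 0" "sgn (grad_x \<phi> (x0, t0)) = b"
      using pos False N0 by (simp_all add: gu b_def sgn_scaleR)
    have gv': "grad_x \<psi> (y0, s0) \<noteq> 0" "sgn (grad_x \<psi> (y0, s0)) = - b"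
      unfolding gv using pos False N0 by (simp_all only: sgn_scaleR sgn_minus b_def) simp_all
    define n where "n = real CARD('n)"
    have n: "n > 0" by (simp add: n_def)
    define k where "k = min 1 (l / (16 * N * n))"
    have k: "0 < k" "k \<le> 1" using N n l by (auto simp: k_def)
    have "k \<le> l / (16 * N * n)" by (simp add: k_def)
    then have c0: "2 * N * n * k \<le> l / 8" using N n by (simp add: field_simps)
    from u.sconv_frozen_equation[OF subu tpos(1) sm(1) maxu gu'(1) k(1)] obtain r1 where
      r1: "r1 > 0" "\<And>\<xi> x t. smooth \<xi> \<Longrightarrow> dist x x0 < r1 \<Longrightarrow> \<bar>t - t0\<bar> < r1 \<Longrightarrow>
        local_max_at (\<lambda>(x, t). ?U x t - \<xi> (x, t)) (x, t) \<Longrightarrow>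
        Dt \<xi> (x, t) \<le> Lin b k \<xi> (x, t) + 2 * N * n * k"
      unfolding gu'(2) n_def by blast
    from v.sconv_frozen_equation[OF subv tpos(2) sm(2) maxv gv'(1) k(1)] obtain r2 where
      r2: "r2 > 0" "\<And>\<xi> x t. smooth \<xi> \<Longrightarrow> dist x y0 < r2 \<Longrightarrow> \<bar>t - s0\<bar> < r2 \<Longrightarrow>
        local_max_at (\<lambda>(x, t). ?V x t - \<xi> (x, t)) (x, t) \<Longrightarrow>
        Dt \<xi> (x, t) \<le> Lin (- b) k \<xi> (x, t) + 2 * N * n * k"
      unfolding gv'(2) n_def by blast
    define r where "r = min (min r1 r2) (min 1 (min (t0 - t1) (s0 - t1)))"
    have r: "0 < r" "r \<le> 1" "r \<le> r1" "r \<le> r2" "r \<le> t0 - t1" "r \<le> s0 - t1"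
      using r1(1) r2(1) t1 by (auto simp: r_def)
    have K: "K \<ge> 0" by (rule u.K_nonneg)
    \<comment> \<open>Outside radius \<open>r\<close> the barrier must cover the gap between
      \<open>h + h'\<close>, at most about \<open>2 * K\<close>, and the values at the maximum, at
      least \<open>- 2 * K\<close>, besides \<open>l * \<tau> \<le> 1\<close>.\<close>
    define C where "C = (4 * K + 4) / r ^ 4"
    have C: "C * r ^ 4 = 4 * K + 4" "C > 0" using r K by (auto simp: C_def)
    define B where "B = C * (4 * n + 8)\<^sup>2"
    have B: "B \<ge> 0" using C by (simp add: B_def)
    \<comment> \<open>The three bounds give \<open>\<tau> < r^2\<close>,
      \<open>l * \<tau> \<le> 1\<close>, and a barrier value \<open>B * \<tau> * \<tau>\<close> at
      the centre of at most \<open>l * \<tau> / 16\<close>.\<close>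
    define \<tau> where "\<tau> = min (r\<^sup>2 / 2) (min (1 / l) (l / (16 * (B + 1))))"
    have \<tau>: "0 < \<tau>" "\<tau> < r\<^sup>2" "\<tau> \<le> 1 / l" "\<tau> \<le> l / (16 * (B + 1))"
    proof -
      show "0 < \<tau>" using r l B by (simp add: \<tau>_def)
      have "\<tau> \<le> r\<^sup>2 / 2" unfolding \<tau>_def by (rule min.cobounded1)
      moreover have "r\<^sup>2 > 0" using r by simp
      ultimately show "\<tau> < r\<^sup>2" by linarith
    qed (auto simp: \<tau>_def)
    have l\<tau>: "l * \<tau> \<le> 1" using \<tau> l by (simp add: field_simps)
    have "r\<^sup>2 \<le> r" using r by (simp add: power2_eq_square mult_left_le)
    then have \<tau>r: "\<tau> < r" using \<tau> by simp
    have barC: "C * bar2 0 0 (0 :: real^'n, \<tau>) = B * \<tau> * \<tau>"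
      by (simp add: bar2_def bar_def nsq_def B_def n_def power2_eq_square)
    have "16 * (B + 1) * \<tau> \<le> l" using \<tau>(4) B by (simp add: field_simps)
    moreover have "16 * (B + 1) * \<tau> = 16 * (B * \<tau>) + 16 * \<tau>" by (simp add: algebra_simps)
    ultimately have "B * \<tau> \<le> l / 16" using \<tau>(1) by linarith
    then have B\<tau>: "B * \<tau> * \<tau> \<le> l / 16 * \<tau>" using \<tau> by (intro mult_right_mono) auto
    \<comment> \<open>The approximation is chosen after \<tau>, since its error must be a small
      fraction of the gain \<open>l * \<tau>\<close>.\<close>
    define e where "e = min (1 / 2) (min (l * \<tau> / 32) (l / 16))"
    have e: "0 < e" "e < 1" "e \<le> l * \<tau> / 32" "e \<le> l / 16"
      using l \<tau> by (auto simp: e_def)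
    have "e * \<tau> \<le> l / 16 * \<tau>" using e \<tau> by (intro mult_right_mono) auto
    have C2: "C * r ^ 4 \<ge> 2 * K + 2" "C \<ge> 0" using C K by auto
    have b1: "norm b \<le> 1" and k0: "0 \<le> k" and l8: "l / 8 \<ge> 0" using b k l by auto
    have "\<exists>h\<in>heat b k. (\<forall>y. norm y \<le> 1 \<longrightarrow> \<bar>h (y, 0) - ?U (x0 + y) (t0 - \<tau>)\<bar> \<le> e)
      \<and> (\<forall>y. \<bar>h (y, 0)\<bar> \<le> K + e)
      \<and> ?U x0 t0 \<le> h (0, \<tau>) + e + (l / 8 + e) * \<tau> + C * bar2 0 0 (0 :: real^'n, \<tau>)"
    proof (rule parabolic_bound[OF u.continuous_on_sconv u.sconv_bound b1 k0 k(2) r(1,2) _ _ l8 \<tau>(1,2) e(1,2) C2])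
      fix \<xi> x t
      assume "smooth \<xi>" "dist x x0 < r" "\<bar>t - t0\<bar> < r"
        "local_max_at (\<lambda>(x, t). ?U x t - \<xi> (x, t)) (x, t)"
      then show "Dt \<xi> (x, t) \<le> Lin b k \<xi> (x, t) + l / 8"
        using r1(2)[of \<xi> x t] r c0 by auto
    qed (use r t1 in auto)
    then obtain h where h: "h \<in> heat b k"
      "\<And>y. norm y \<le> 1 \<Longrightarrow> \<bar>h (y, 0) - ?U (x0 + y) (t0 - \<tau>)\<bar> \<le> e"
      "\<And>y. \<bar>h (y, 0)\<bar> \<le> K + e"
      "?U x0 t0 \<le> h (0, \<tau>) + e + (l / 8 + e) * \<tau> + C * bar2 0 0 (0 :: real^'n, \<tau>)" by blast
    have "\<exists>h\<in>heat b k. (\<forall>y. norm y \<le> 1 \<longrightarrow> \<bar>h (y, 0) - ?V (y0 + y) (s0 - \<tau>)\<bar> \<le> e)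
      \<and> (\<forall>y. \<bar>h (y, 0)\<bar> \<le> K + e)
      \<and> ?V y0 s0 \<le> h (0, \<tau>) + e + (l / 8 + e) * \<tau> + C * bar2 0 0 (0 :: real^'n, \<tau>)"
    proof (rule parabolic_bound[OF v.continuous_on_sconv v.sconv_bound b1 k0 k(2) r(1,2) _ _ l8 \<tau>(1,2) e(1,2) C2])
      fix \<xi> x t
      assume "smooth \<xi>" "dist x y0 < r" "\<bar>t - s0\<bar> < r"
        "local_max_at (\<lambda>(x, t). ?V x t - \<xi> (x, t)) (x, t)"
      then show "Dt \<xi> (x, t) \<le> Lin b k \<xi> (x, t) + l / 8"
        using r2(2)[of \<xi> x t] r c0 by (auto simp: Lin_minus_direction)
    qed (use r t1 in auto)
    then obtain h' where h': "h' \<in> heat b k"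
      "\<And>y. norm y \<le> 1 \<Longrightarrow> \<bar>h' (y, 0) - ?V (y0 + y) (s0 - \<tau>)\<bar> \<le> e"
      "\<And>y. \<bar>h' (y, 0)\<bar> \<le> K + e"
      "?V y0 s0 \<le> h' (0, \<tau>) + e + (l / 8 + e) * \<tau> + C * bar2 0 0 (0 :: real^'n, \<tau>)" by blast
    \<comment> \<open>The common translation backwards in time gains \<open>l * \<tau>\<close>; the
      two approximations cost \<open>2 * e\<close>.\<close>
    define M where "M = ?U x0 t0 + ?V y0 s0 - l * \<tau> + 2 * e"
    have "h (0, \<tau>) + h' (0, \<tau>) \<le> M + C * bar2 0 0 (0 :: real^'n, \<tau>)"
    proof (rule max_principle[OF heat.add[OF h(1) h'(1)] b1 k0 k(2) C2(2)])
      fix y :: "real^'n"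
      show "h (y, 0) + h' (y, 0) \<le> M + C * bar2 0 0 (y, 0)"
      proof (cases "norm y \<le> r")
        case True
        then have "norm y \<le> 1" using r by simp
        have "?U (x0 + y) (t0 - \<tau>) + ?V (y0 + y) (s0 - \<tau>) \<le> ?U x0 t0 + ?V y0 s0 - l * \<tau>"
          using max[of "t0 - \<tau>" "s0 - \<tau>" "x0 + y" "y0 + y"] \<tau>r r by (simp add: algebra_simps)
        moreover have "C * bar2 0 0 (y, 0) \<ge> 0" by (intro mult_nonneg_nonneg C2 bar2_nonneg)
        ultimately show ?thesis
          using h(2)[OF \<open>norm y \<le> 1\<close>] h'(2)[OF \<open>norm y \<le> 1\<close>] unfolding M_def by linarith
      next
        case False
        then have "r ^ 4 \<le> norm y ^ 4" using r by (intro power_mono) auto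
        then have "C * r ^ 4 \<le> C * bar2 0 0 (y, 0)" using C2
          by (intro mult_left_mono)
             (auto simp: bar2_def bar_def nsq_def power4_eq_xxxx power2_eq_square mult.assoc)
        moreover have "h (y, 0) \<le> K + e" "h' (y, 0) \<le> K + e" using h(3)[of y] h'(3)[of y] by auto
        moreover have "?U x0 t0 \<ge> - K" "?V y0 s0 \<ge> - K"
          using u.sconv_bound[of t0 x0] v.sconv_bound[of s0 y0] tpos by auto
        ultimately show ?thesis using C(1) l\<tau> unfolding M_def by linarith
      qed
    qed (use \<tau> in simp)
    \<comment> \<open>The errors amount to at most \<open>11/16\<close> of
      \<open>l * \<tau>\<close>. The barrier is counted three times, once for each local bound and
      once for the maximum principle.\<close>
    then have "?U x0 t0 + ?V y0 s0 \<le> ?U x0 t0 + ?V y0 s0 - l * \<tau> + 4 * e + 2 * ((l / 8 + e) * \<tau>) + 3 * (B * \<tau> * \<tau>)"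
      using h(4) h'(4) unfolding barC M_def by linarith
    moreover have "(l / 8 + e) * \<tau> = l * \<tau> / 8 + e * \<tau>" by (simp add: algebra_simps)
    moreover have "e * \<tau> \<le> l * \<tau> / 16" "B * \<tau> * \<tau> \<le> l * \<tau> / 16"
      using \<open>e * \<tau> \<le> l / 16 * \<tau>\<close> B\<tau> by simp_all
    moreover have "l * \<tau> > 0" using l \<tau> by simp
    ultimately show False using e(3) by linarith
  qed
qed

subsection \<open>Comparison\<close>

text \<open>A paraboloid centred at a far point \<open>x1\<close>, rising linearly in time,
  dominates \<open>u\<close> initially and on the rest of the boundary of a cylinder of radius
  \<open>r\<close>. At its centre it exceeds \<open>c\<close> by an amount of order
  \<open>t1 / r^2\<close>, and \<open>r\<close> can be taken large.\<close>

lemma spatial_decay: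
  fixes u :: "real^'n::finite \<Rightarrow> real \<Rightarrow> real"
  assumes sub: "mcf_visc_sub u" and K: "\<And>x t. t \<ge> 0 \<Longrightarrow> \<bar>u x t\<bar> \<le> K"
    and S: "S > 0" and init: "\<And>x. norm x \<ge> S \<Longrightarrow> u x 0 \<le> c"
    and T: "T \<ge> 0" and e: "e > 0"
  shows "\<exists>R. \<forall>x t. norm x \<ge> R \<longrightarrow> 0 \<le> t \<longrightarrow> t \<le> T \<longrightarrow> u x t \<le> c + e"
proof -
  have cont: "continuous_on (UNIV \<times> {0..}) (\<lambda>(x, t). u x t)"
    using sub by (simp add: mcf_visc_sub_def cont_bdd_def)
  \<comment> \<open>Exceeds by one the Laplacian \<open>2 * n\<close> of the squared distance,
    \<open>n\<close> being the dimension, so the barrier is a strict supersolution.\<close>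
  define m where "m = 2 * real CARD('n) + 1"
  have m: "m \<ge> 1" by (simp add: m_def)
  \<comment> \<open>Ensures that the barrier value \<open>c + D\<close> on the boundary is at least
    \<open>K + 1\<close>.\<close>
  define D where "D = K + \<bar>c\<bar> + 1"
  have "K \<ge> 0" using K[of 0 0] by simp
  then have D: "D > 0" by (simp add: D_def)
  have barrier: "u x1 t1 \<le> c + D / r\<^sup>2 * (m * t1)"
    if r: "r > 0" "norm x1 \<ge> S + r" and "t1 \<ge> 0" for x1 t1 r
  proof (rule ccontr)
    assume neg: "\<not> ?thesis"
    define \<psi> where "\<psi> p = (c + (D / r\<^sup>2 * m) * (snd p - 0)) + D / r\<^sup>2 * nsq x1 p" for p
    have q: "D / r\<^sup>2 > 0" using D r by simp
    have s: "smooth \<psi>" unfolding \<psi>_def by (intro smooth_add smooth_time smooth_cmult smooth_nsq)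
    let ?G = "\<lambda>(x, t). u x t - \<psi> (x, t)"
    let ?S = "cball x1 r \<times> {0..r\<^sup>2}"
    have G1: "?G (x1, t1) > 0" using neg by (simp add: \<psi>_def nsq_def)
    have far: "?G (x, t) \<le> 0" if "t \<ge> 0" "r \<le> norm (x - x1) \<or> r\<^sup>2 \<le> t" for x t
    proof -
      have "r\<^sup>2 \<le> nsq x1 (x, t) + m * t"
      proof (cases "r \<le> norm (x - x1)")
        case True
        then have "r\<^sup>2 \<le> nsq x1 (x, t)" using r by (simp add: nsq_def power_mono)
        then show ?thesis using m that by (simp add: add_increasing2)
      next
        case False
        then have "r\<^sup>2 \<le> t" using that by simp
        also have "1 * t \<le> m * t" using m that by (intro mult_right_mono) auto
        finally show ?thesis by (simp add: nsq_def add_increasing)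
      qed
      then have "D / r\<^sup>2 * r\<^sup>2 \<le> D / r\<^sup>2 * (nsq x1 (x, t) + m * t)"
        using q by (intro mult_left_mono) auto
      moreover have "D / r\<^sup>2 * r\<^sup>2 = D" using r by simp
      ultimately have "\<psi> (x, t) \<ge> c + D" by (simp add: \<psi>_def algebra_simps)
      then show ?thesis using K[OF that(1), of x] by (simp add: D_def)
    qed
    have in1: "(x1, t1) \<in> ?S" using far[of t1 x1] G1 \<open>t1 \<ge> 0\<close> r by force
    have "compact ?S" by (intro compact_Times compact_cball compact_Icc)
    moreover have "continuous_on ?S (\<lambda>p. (\<lambda>(x, t). u x t) p - \<psi> p)"
      by (intro continuous_on_diff continuous_on_smooth[OF s] continuous_on_subset[OF cont]) auto
    then have "continuous_on ?S ?G" by (simp add: case_prod_unfold)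
    ultimately obtain z where z: "z \<in> ?S" "\<And>y. y \<in> ?S \<Longrightarrow> ?G y \<le> ?G z"
      using in1 continuous_attains_sup[of ?S ?G] by blast
    obtain x t where [simp]: "z = (x, t)" by (cases z)
    have Gz: "?G (x, t) > 0" using z(2)[OF in1] G1 by simp
    have t: "t \<ge> 0" using z(1) by simp
    have inn: "norm (x - x1) < r" "t < r\<^sup>2" using far[of t x] Gz t by force+
    have "t \<noteq> 0"
    proof
      assume [simp]: "t = 0"
      have "norm x \<ge> S" using inn(1) r(2) norm_triangle_ineq2[of x1 x] by (simp add: norm_minus_commute)
      then have "u x 0 \<le> c" by (rule init)
      moreover have "D / r\<^sup>2 * nsq x1 (x, 0) \<ge> 0" using q by (intro mult_nonneg_nonneg) (auto simp: nsq_def)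
      ultimately show False using Gz by (simp add: \<psi>_def)
    qed
    then have tp: "t > 0" using t by simp
    have max: "local_max_at (\<lambda>(x, t). u x t - \<psi> (x, t)) (x, t)"
    proof (rule local_max_atI)
      show "open (ball x1 r \<times> {0<..<r\<^sup>2})" by (intro open_Times open_ball open_greaterThanLessThan)
      show "(x, t) \<in> ball x1 r \<times> {0<..<r\<^sup>2}" using inn tp by (simp add: dist_norm norm_minus_commute)
      fix p assume "p \<in> ball x1 r \<times> {0<..<r\<^sup>2}"
      then have "p \<in> ?S" by auto
      from z(2)[OF this] show "?G p \<le> ?G (x, t)" by simp
    qed
    \<comment> \<open>Zero and nonzero gradient are treated alike: the barrier is convex in space,
      so subtracting its second derivative in any direction leaves at most the Laplacian.\<close>
    have "\<exists>\<eta>. Dt \<psi> (x, t) \<le> mcf_op \<eta> \<psi> (x, t)"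
      using sub s tp max unfolding mcf_visc_sub_def by blast
    then obtain \<eta> where "Dt \<psi> (x, t) \<le> Lap \<psi> (x, t) - D2 \<eta> \<eta> \<psi> (x, t)"
      using mcf_op_eq[OF s] by auto
    moreover have "Dt \<psi> (x, t) = D / r\<^sup>2 * m"
      unfolding \<psi>_def by (simp only: Dt_add Dt_cmult smooth_time smooth_cmult smooth_nsq Dt_time)
        (simp add: Dt_def dirD_nsq)
    moreover have D2: "D2 v w \<psi> (x, t) = D / r\<^sup>2 * (2 * (v \<bullet> w))" for v w
      unfolding \<psi>_def
      by (simp only: D2_add D2_cmult smooth_time smooth_cmult smooth_nsq D2_time D2_nsq add_0_left)
    moreover have "Lap \<psi> (x, t) = D / r\<^sup>2 * (2 * real CARD('n))"
      by (simp add: Lap_def D2 inner_axis_axis)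
    moreover have "D2 \<eta> \<eta> \<psi> (x, t) \<ge> 0"
      unfolding D2 using q by (intro mult_nonneg_nonneg) auto
    ultimately have "D / r\<^sup>2 * m \<le> D / r\<^sup>2 * (2 * real CARD('n))" by linarith
    then show False using q by (simp only: mult_le_cancel_left_pos) (simp add: m_def)
  qed
  \<comment> \<open>The radius will be \<open>1 + a\<close>; then \<open>D * m * T = e * a\<close>
    is at most \<open>e * (1 + a)^2\<close>.\<close>
  define a where "a = D * m * T / e"
  have a: "a \<ge> 0" using D m T e by (simp add: a_def)
  show ?thesis
  proof (intro exI[of _ "S + (1 + a)"] allI impI)
    fix x :: "real^'n" and t :: real
    assume x: "S + (1 + a) \<le> norm x" and t: "0 \<le> t" "t \<le> T"
    have "u x t \<le> c + D / (1 + a)\<^sup>2 * (m * t)" using a x t by (intro barrier) auto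
    also have "D / (1 + a)\<^sup>2 * (m * t) = D * m * t / (1 + a)\<^sup>2" by simp
    also have "\<dots> \<le> e"
    proof -
      have "D * m * t \<le> D * m * T" using D m t by (intro mult_left_mono) auto
      also have "\<dots> = e * a" using e by (simp add: a_def)
      also have "\<dots> \<le> e * (1 + a)\<^sup>2"
        using e a by (intro mult_left_mono) (auto simp: power2_eq_square algebra_simps add_increasing)
      finally show ?thesis using a by (simp add: pos_divide_le_eq)
    qed
    finally show "u x t \<le> c + e" by simp
  qed
qed

lemma uniform_modulus:
  fixes u :: "real^'n::finite \<Rightarrow> real \<Rightarrow> real"
  assumes cont: "continuous_on (UNIV \<times> {0..}) (\<lambda>(x, t). u x t)"
    and far: "\<And>x t. norm x \<ge> R \<Longrightarrow> 0 \<le> t \<Longrightarrow> t \<le> T \<Longrightarrow> \<bar>u x t - c\<bar> \<le> e / 4"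
    and e: "e > 0"
  shows "\<exists>\<rho>>0. \<forall>x y t s. 0 \<le> t \<longrightarrow> t \<le> T \<longrightarrow> 0 \<le> s \<longrightarrow> s \<le> T \<longrightarrow>
    norm (x - y) < \<rho> \<longrightarrow> \<bar>t - s\<bar> < \<rho> \<longrightarrow> \<bar>u x t - u y s\<bar> \<le> e"
proof -
  let ?S = "cball (0 :: real^'n) (R + 1) \<times> {0..T}"
  have "uniformly_continuous_on ?S (\<lambda>(x, t). u x t)"
    by (intro compact_uniformly_continuous compact_Times compact_cball compact_Icc
        continuous_on_subset[OF cont]) auto
  then obtain d where d: "d > 0"
    "\<And>p q. p \<in> ?S \<Longrightarrow> q \<in> ?S \<Longrightarrow> dist p q < d \<Longrightarrow>
      dist ((\<lambda>(x, t). u x t) p) ((\<lambda>(x, t). u x t) q) < e"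
    unfolding uniformly_continuous_on_def using e by metis
  show ?thesis
  \<comment> \<open>Points at distance below \<open>1\<close> either both lie in the larger ball or
    both have norm at least \<open>R\<close>.\<close>
  proof (intro exI[of _ "min (d / 2) 1"] conjI allI impI)
    fix x y :: "real^'n" and t s :: real
    assume *: "0 \<le> t" "t \<le> T" "0 \<le> s" "s \<le> T" "norm (x - y) < min (d / 2) 1" "\<bar>t - s\<bar> < min (d / 2) 1"
    have tri: "norm x \<le> norm y + norm (x - y)" "norm y \<le> norm x + norm (x - y)"
      using norm_triangle_ineq2[of x y] norm_triangle_ineq2[of y x] by (simp_all add: norm_minus_commute)
    show "\<bar>u x t - u y s\<bar> \<le> e"
    proof (cases "norm x \<le> R + 1 \<and> norm y \<le> R + 1")
      case True
      have "dist (x, t) (y, s) \<le> dist x y + dist t s"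
        unfolding dist_Pair_Pair by (rule sqrt_sum_squares_le_sum) auto
      then have "dist (x, t) (y, s) < d" using * by (simp add: dist_norm)
      from d(2)[OF _ _ this] True * show ?thesis by (simp add: dist_real_def)
    next
      case False
      then have "norm x \<ge> R" "norm y \<ge> R" using tri * by auto
      then have "\<bar>u x t - c\<bar> \<le> e / 4" "\<bar>u y s - c\<bar> \<le> e / 4" using far * by auto
      then show ?thesis using e by linarith
    qed
  qed (use d in simp)
qed

text \<open>At spatial infinity the sum tends to zero, so with \<open>m \<ge> 0\<close> an excess
  over \<open>m\<close> is attained in a bounded region. The term \<open>l * t\<close> confines it
  in time too, and the maximum is global over all later times, without a terminal boundary.\<close>

lemma comparison:
  fixes u v :: "real^'n::finite \<Rightarrow> real \<Rightarrow> real"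
  assumes subu: "mcf_visc_sub u" and subv: "mcf_visc_sub v"
    and Ku: "\<And>x t. t \<ge> 0 \<Longrightarrow> \<bar>u x t\<bar> \<le> K" and Kv: "\<And>x t. t \<ge> 0 \<Longrightarrow> \<bar>v x t\<bar> \<le> K"
    and faru: "\<And>T e. T \<ge> 0 \<Longrightarrow> e > 0 \<Longrightarrow> \<exists>R. \<forall>x t. norm x \<ge> R \<longrightarrow> 0 \<le> t \<longrightarrow> t \<le> T \<longrightarrow> \<bar>u x t - c\<bar> \<le> e"
    and farv: "\<And>T e. T \<ge> 0 \<Longrightarrow> e > 0 \<Longrightarrow> \<exists>R. \<forall>x t. norm x \<ge> R \<longrightarrow> 0 \<le> t \<longrightarrow> t \<le> T \<longrightarrow> \<bar>v x t + c\<bar> \<le> e"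
    and m: "m \<ge> 0" and t12: "0 \<le> t1" "t1 < t2"
    and init: "\<And>x. u (x + z) t1 + v x t1 \<le> m"
  shows "u (xs + z) t2 + v xs t2 \<le> m"
proof (rule ccontr)
  assume neg: "\<not> ?thesis"
  \<comment> \<open>One third of the excess pays for \<open>l * t2\<close>, one for the uniform
    modulus at the initial time, and one remains for the contradiction.\<close>
  define \<delta> where "\<delta> = (u (xs + z) t2 + v xs t2 - m) / 3"
  have \<delta>: "\<delta> > 0" using neg by (simp add: \<delta>_def)
  have K: "K \<ge> 0" using Ku[of 0 0] by simp
  have t2: "t2 > 0" using t12 by simp
  define l where "l = \<delta> / t2"
  have l: "l > 0" "l * t2 = \<delta>" using \<delta> t2 by (auto simp: l_def)
  \<comment> \<open>Where \<open>W\<close> is at least \<open>2 * \<delta>\<close> the term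
    \<open>l * t\<close> is at most \<open>2 * K\<close>; the summand \<open>1\<close> makes room
    for the other time.\<close>
  define T where "T = max t2 (2 * K / l + 1)"
  have T: "T \<ge> t2" "T \<ge> 2 * K / l + 1" "T > 0" using t2 by (auto simp: T_def)
  have cu: "continuous_on (UNIV \<times> {0..}) (\<lambda>(x, t). u x t)"
    and cv: "continuous_on (UNIV \<times> {0..}) (\<lambda>(x, t). v x t)"
    using subu subv by (simp_all add: mcf_visc_sub_def cont_bdd_def)
  obtain Ru where Ru: "\<And>x t. norm x \<ge> Ru \<Longrightarrow> 0 \<le> t \<Longrightarrow> t \<le> T \<Longrightarrow> \<bar>u x t - c\<bar> \<le> \<delta> / 4"
    using faru[of T "\<delta> / 4"] T \<delta> by auto
  obtain Rv where Rv: "\<And>x t. norm x \<ge> Rv \<Longrightarrow> 0 \<le> t \<Longrightarrow> t \<le> T \<Longrightarrow> \<bar>v x t + c\<bar> \<le> \<delta> / 4"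
    using farv[of T "\<delta> / 4"] T \<delta> by auto
  obtain \<rho>u where \<rho>u: "\<rho>u > 0" "\<And>x y t s. 0 \<le> t \<Longrightarrow> t \<le> T \<Longrightarrow> 0 \<le> s \<Longrightarrow> s \<le> T \<Longrightarrow>
      norm (x - y) < \<rho>u \<Longrightarrow> \<bar>t - s\<bar> < \<rho>u \<Longrightarrow> \<bar>u x t - u y s\<bar> \<le> \<delta>"
    using uniform_modulus[of u Ru T c \<delta>, OF cu _ \<delta>] Ru by blast
  have Rv': "\<bar>v x t - (- c)\<bar> \<le> \<delta> / 4" if "norm x \<ge> Rv" "0 \<le> t" "t \<le> T" for x t
    using Rv[OF that] by simp
  obtain \<rho>v where \<rho>v: "\<rho>v > 0" "\<And>x y t s. 0 \<le> t \<Longrightarrow> t \<le> T \<Longrightarrow> 0 \<le> s \<Longrightarrow> s \<le> T \<Longrightarrow>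
      norm (x - y) < \<rho>v \<Longrightarrow> \<bar>t - s\<bar> < \<rho>v \<Longrightarrow> \<bar>v x t - v y s\<bar> \<le> \<delta>"
    using uniform_modulus[of v Rv T "- c" \<delta>, OF cv _ \<delta>] Rv' by blast
  \<comment> \<open>Three distances of size \<sigma> (two to the maximizers, one between the doubled
    points) separate \<open>x'\<close> from \<open>y' + z\<close>; four stay within both
    moduli.\<close>
  define \<sigma> where "\<sigma> = min (min \<rho>u \<rho>v) 1 / 4"
  have \<sigma>: "\<sigma> > 0" "\<sigma> < 1" "4 * \<sigma> \<le> \<rho>u" "4 * \<sigma> \<le> \<rho>v" using \<rho>u(1) \<rho>v(1) by (auto simp: \<sigma>_def)
  \<comment> \<open>The fourth power matches the quartic penalty; since \<open>\<sigma> < 1\<close>,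
    it also covers the quadratic penalties of time and sup-convolution.\<close>
  define N where "N = (2 * K + 1) / \<sigma> ^ 4"
  have N: "N > 0" using K \<sigma> by (simp add: N_def)
  have KN: "2 * K / N \<le> \<sigma> ^ 4"
  proof -
    have "N * \<sigma> ^ 4 = 2 * K + 1" using \<sigma> by (simp add: N_def)
    then have "2 * K \<le> \<sigma> ^ 4 * N" by (simp add: mult.commute)
    then show ?thesis using N by (simp add: pos_divide_le_eq)
  qed
  have \<sigma>4: "\<sigma> ^ 4 \<le> \<sigma>\<^sup>2" using \<sigma> by (intro power_decreasing) auto
  have KN2: "sqrt (2 * K / N) \<le> \<sigma>"
    using order_trans[OF KN \<sigma>4] \<sigma> by (intro real_le_lsqrt) auto
  interpret u: bounded_continuous u K N using cu Ku N by unfold_locales auto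
  interpret v: bounded_continuous v K N using cv Kv N by unfold_locales auto
  let ?U = "sconv N u" and ?V = "sconv N v"
  define W where "W = (\<lambda>((x, y), (t, s)). ?U x t + ?V y s - N * ((norm (x - y - z))\<^sup>2)\<^sup>2 - N * (t - s)\<^sup>2 - l * t)"
  \<comment> \<open>The margin covers passing from \<open>x\<close> to \<open>y\<close>
    (\<open>norm z\<close> and at most \<open>1\<close>) and from each point to its maximizer (at
    most \<open>1\<close>).\<close>
  define R where "R = max Ru Rv + norm z + 3"
  define R' where "R' = max R 0 + norm z + 1"
  have bounds: "norm (x - y - z) \<le> \<sigma>" "\<bar>t - s\<bar> \<le> \<sigma>" "t \<le> T" "s \<le> T" "norm x < R" "norm y \<le> R'"
    if W: "W ((x, y), (t, s)) \<ge> 2 * \<delta>" and ts: "t \<ge> 0" "s \<ge> 0" for x y t s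
  proof -
    have "?U x t \<le> K" "?V y s \<le> K" using u.sconv_bound[of t x] v.sconv_bound[of s y] ts by auto
    moreover have "N * ((norm (x - y - z))\<^sup>2)\<^sup>2 \<ge> 0" "N * (t - s)\<^sup>2 \<ge> 0" "l * t \<ge> 0" using N l ts by auto
    ultimately have b: "N * ((norm (x - y - z))\<^sup>2)\<^sup>2 \<le> 2 * K" "N * (t - s)\<^sup>2 \<le> 2 * K" "l * t \<le> 2 * K"
      using W \<delta> by (auto simp: W_def)
    have "norm (x - y - z) ^ 4 \<le> 2 * K / N" using b(1) N by (simp add: field_simps)
    then have "norm (x - y - z) ^ 4 \<le> \<sigma> ^ 4" using KN by simp
    then show 1: "norm (x - y - z) \<le> \<sigma>" using \<sigma> by (simp add: power_mono_iff)
    have "(t - s)\<^sup>2 \<le> 2 * K / N" using b(2) N by (simp add: field_simps)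
    then have "(t - s)\<^sup>2 \<le> \<sigma>\<^sup>2" using KN \<sigma>4 by simp
    then show 2: "\<bar>t - s\<bar> \<le> \<sigma>" using abs_le_square_iff[of "t - s" \<sigma>] \<sigma> by simp
    have "t \<le> 2 * K / l" using b(3) l by (simp add: field_simps)
    then show 3: "t \<le> T" "s \<le> T" using T 2 \<sigma> by auto
    have tri: "norm x \<le> norm y + norm z + 1" "norm y \<le> norm x + norm z + 1"
    proof -
      have "x = y + z + (x - y - z)" "y = x - z - (x - y - z)" by simp_all
      then have "norm x \<le> norm (y + z) + norm (x - y - z)" "norm y \<le> norm (x - z) + norm (x - y - z)"
        using norm_triangle_ineq[of "y + z" "x - y - z"] norm_triangle_ineq4[of "x - z" "x - y - z"] by simp_all
      then show "norm x \<le> norm y + norm z + 1" "norm y \<le> norm x + norm z + 1"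
        using norm_triangle_ineq[of y z] norm_triangle_ineq4[of x z] 1 \<sigma> by linarith+
    qed
    show "norm x < R"
    proof (rule ccontr)
      assume "\<not> ?thesis"
      then have x: "norm x \<ge> Ru + norm z + 3" "norm x \<ge> Rv + norm z + 3" by (auto simp: R_def)
      obtain x' where x': "?U x t = u x' t - N * (norm (x' - x))\<^sup>2" using u.sconv_attained ts by blast
      obtain y' where y': "?V y s = v y' s - N * (norm (y' - y))\<^sup>2" using v.sconv_attained ts by blast
      have "norm (x' - x) \<le> 1" "norm (y' - y) \<le> 1"
        using u.maximizer_close[OF ts(1) x'] v.maximizer_close[OF ts(2) y'] KN2 \<sigma> by auto
      then have "norm x' \<ge> Ru" "norm y' \<ge> Rv"
        using x tri norm_triangle_ineq2[of x x'] norm_triangle_ineq2[of y y'] norm_ge_zero[of z]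
          norm_minus_commute[of x x'] norm_minus_commute[of y y'] by linarith+
      then have "\<bar>u x' t - c\<bar> \<le> \<delta> / 4" "\<bar>v y' s + c\<bar> \<le> \<delta> / 4"
        using Ru[of x' t] Rv[of y' s] ts 3 by auto
      moreover have "N * (norm (x' - x))\<^sup>2 \<ge> 0" "N * (norm (y' - y))\<^sup>2 \<ge> 0" using N by auto
      moreover have "?U x t + ?V y s \<ge> 2 * \<delta>"
        using W \<open>N * ((norm (x - y - z))\<^sup>2)\<^sup>2 \<ge> 0\<close> \<open>N * (t - s)\<^sup>2 \<ge> 0\<close> \<open>l * t \<ge> 0\<close> by (simp add: W_def)
      ultimately show False using x' y' \<delta> by linarith
    qed
    then show "norm y \<le> R'" using tri by (auto simp: R'_def)
  qed
  let ?S = "(cball (0 :: real^'n) R' \<times> cball (0 :: real^'n) R') \<times> ({t1..T} \<times> {t1..T})"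
  have "u (xs + z) t2 + v xs t2 = m + 3 * \<delta>" by (simp add: \<delta>_def field_simps)
  then have big: "W ((xs + z, xs), (t2, t2)) \<ge> m + 2 * \<delta>"
    using u.sconv_ge[of t2 "xs + z"] v.sconv_ge[of t2 xs] t2 l(2) by (simp add: W_def)
  have RR: "R \<le> R'" unfolding R'_def using norm_ge_zero[of z] max.cobounded1[of R 0] by linarith
  have inS: "((x, y), (t, s)) \<in> ?S" if "W ((x, y), (t, s)) \<ge> 2 * \<delta>" "t \<ge> t1" "s \<ge> t1" for x y t s
    using bounds[OF that(1)] that(2,3) t12 RR by auto
  have "compact ?S" by (intro compact_Times compact_cball compact_Icc)
  moreover have "continuous_on ?S W"
  proof -
    have "continuous_on ?S (\<lambda>q. (\<lambda>(x, t). ?U x t) (fst (fst q), fst (snd q))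
        + (\<lambda>(x, t). ?V x t) (snd (fst q), snd (snd q))
        - N * ((norm (fst (fst q) - snd (fst q) - z))\<^sup>2)\<^sup>2 - N * (fst (snd q) - snd (snd q))\<^sup>2 - l * fst (snd q))"
      using t12
      by (intro continuous_on_diff continuous_on_add continuous_on_mult continuous_on_power
          continuous_on_norm continuous_on_const continuous_on_fst continuous_on_snd continuous_on_id
          continuous_on_compose2[OF u.continuous_on_sconv] continuous_on_compose2[OF v.continuous_on_sconv]
          continuous_on_Pair) auto
    then show ?thesis by (simp add: W_def case_prod_unfold)
  qed
  moreover have in2: "((xs + z, xs), (t2, t2)) \<in> ?S"
    by (rule inS) (use big m t12 in auto)
  ultimately obtain q where q: "q \<in> ?S" "\<And>p. p \<in> ?S \<Longrightarrow> W p \<le> W q"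
    using continuous_attains_sup[of ?S W] by blast
  obtain x0 y0 t0 s0 where [simp]: "q = ((x0, y0), (t0, s0))" by (metis prod.exhaust)
  have Wq: "W ((x0, y0), (t0, s0)) \<ge> m + 2 * \<delta>" using q(2)[OF in2] big by simp
  \<comment> \<open>A point where \<open>W\<close> is below \<open>2 * \<delta>\<close> cannot
    compete, and all others lie in the compact set, so the maximum there is global.\<close>
  have max: "W ((x, y), (t, s)) \<le> W ((x0, y0), (t0, s0))" if "t1 \<le> t" "t1 \<le> s" for x y t s
  proof (cases "W ((x, y), (t, s)) \<ge> 2 * \<delta>")
    case True
    then show ?thesis using q(2)[OF inS[OF True that]] by simp
  qed (use Wq m in simp)
  have t0: "t1 \<le> t0" "t1 \<le> s0" "0 \<le> t0" "0 \<le> s0" "t0 \<le> T" "s0 \<le> T" using q(1) t12 by auto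
  have W2: "W ((x0, y0), (t0, s0)) \<ge> 2 * \<delta>" using Wq m by simp
  note b = bounds[OF W2 t0(3,4)]
  obtain x' where x': "?U x0 t0 = u x' t0 - N * (norm (x' - x0))\<^sup>2" using u.sconv_attained t0 by blast
  obtain y' where y': "?V y0 s0 = v y' s0 - N * (norm (y' - y0))\<^sup>2" using v.sconv_attained t0 by blast
  have cl: "norm (x' - x0) \<le> \<sigma>" "norm (y' - y0) \<le> \<sigma>"
    using u.maximizer_close[OF t0(3) x'] v.maximizer_close[OF t0(4) y'] KN2 by auto
  have dz: "norm (x' - (y' + z)) < 4 * \<sigma>"
  proof -
    have "x' - (y' + z) = (x' - x0) + (x0 - y0 - z) - (y' - y0)" by simp
    then have "norm (x' - (y' + z)) = norm ((x' - x0) + (x0 - y0 - z) - (y' - y0))" by (rule arg_cong)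
    then have "norm (x' - (y' + z)) \<le> norm (x' - x0) + norm (x0 - y0 - z) + norm (y' - y0)"
      using norm_triangle_ineq4[of "(x' - x0) + (x0 - y0 - z)" "y' - y0"]
        norm_triangle_ineq[of "x' - x0" "x0 - y0 - z"] by linarith
    then show ?thesis using cl b(1) \<sigma> by linarith
  qed
  have up: "m + 2 * \<delta> \<le> u x' t0 + v y' s0"
  proof -
    have "N * ((norm (x0 - y0 - z))\<^sup>2)\<^sup>2 \<ge> 0" "N * (t0 - s0)\<^sup>2 \<ge> 0" "l * t0 \<ge> 0"
      "N * (norm (x' - x0))\<^sup>2 \<ge> 0" "N * (norm (y' - y0))\<^sup>2 \<ge> 0" using N l t0 by auto
    then show ?thesis using Wq x' y' by (simp add: W_def)
  qed
  \<comment> \<open>Otherwise both maximizers could be moved to a single admissible pair at time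
    \<open>t1\<close> at a cost of \<delta>, giving at most \<open>m + \<delta>\<close> by
    \<open>init\<close>.\<close>
  have "t0 \<noteq> t1"
  proof
    assume [simp]: "t0 = t1"
    have "\<bar>v y' s0 - v (x' - z) t1\<bar> \<le> \<delta>"
    proof (rule \<rho>v(2))
      show "norm (y' - (x' - z)) < \<rho>v"
        using dz \<sigma> norm_minus_commute[of "y'" "x' - z"] by (simp add: algebra_simps)
      show "\<bar>s0 - t1\<bar> < \<rho>v" using b(2) \<sigma> by (simp add: abs_minus_commute)
    qed (use t0 t12 in auto)
    then show False using up init[of "x' - z"] \<delta> by (simp add: abs_le_iff)
  qed
  moreover have "s0 \<noteq> t1"
  proof
    assume [simp]: "s0 = t1"
    have "\<bar>u x' t0 - u (y' + z) t1\<bar> \<le> \<delta>"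
    proof (rule \<rho>u(2))
      show "norm (x' - (y' + z)) < \<rho>u" using dz \<sigma> by simp
      show "\<bar>t0 - t1\<bar> < \<rho>u" using b(2) \<sigma> by simp
    qed (use t0 t12 in auto)
    then show False using up init[of y'] \<delta> by (simp add: abs_le_iff)
  qed
  ultimately have "t1 < t0" "t1 < s0" using t0 by auto
  show False
    by (rule doubling_contradiction[OF u.bounded_continuous_axioms v.bounded_continuous_axioms
          subu subv t12(1) \<open>t1 < t0\<close> \<open>t1 < s0\<close> l(1), of z x0 y0])
       (use max in \<open>simp add: W_def\<close>)
qed

section \<open>Monotonicity of the modulus in time\<close>

lemma mcf_visc_super_minus:
  assumes "mcf_visc_super u"
  shows "mcf_visc_sub (\<lambda>x t. - u x t)"
  unfolding mcf_visc_sub_def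
proof (intro conjI allI impI; (elim conjE)?)
  have cb: "cont_bdd u" using assms by (simp add: mcf_visc_super_def)
  have "continuous_on (UNIV \<times> {0..}) (\<lambda>p. - (\<lambda>(x, t). u x t) p)"
    using cb by (intro continuous_on_minus) (simp add: cont_bdd_def)
  moreover have "bounded (uminus ` (\<lambda>(x, t). u x t) ` (UNIV \<times> {0..}))"
    using cb by (simp add: cont_bdd_def)
  ultimately show "cont_bdd (\<lambda>x t. - u x t)"
    by (simp add: cont_bdd_def case_prod_unfold image_image)
next
  fix \<phi> x0 t0
  assume \<phi>: "smooth \<phi>" and "t0 > 0" and "local_max_at (\<lambda>(x, t). - u x t - \<phi> (x, t)) (x0, t0)"
  then have min: "local_min_at (\<lambda>(x, t). u x t - (- \<phi> (x, t))) (x0, t0)"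
    unfolding local_max_at_def local_min_at_def by fastforce
  have sD: "smooth (Dx j \<phi>)" for j using \<phi> by (simp add: Dx_def smooth_dirD)
  have D1: "Dx j (\<lambda>p. - \<phi> p) = (\<lambda>p. - Dx j \<phi> p)" for j by (simp add: Dx_def dirD_minus \<phi>)
  have D2: "Dx i (\<lambda>p. - Dx j \<phi> p) = (\<lambda>p. - Dx i (Dx j \<phi>) p)" for i j
    unfolding Dx_def[of i] by (rule dirD_minus[OF sD])
  \<comment> \<open>The operator is odd in the test function and even in the direction, so the sign
    change passes through both gradient cases.\<close>
  have eq: "grad_x (\<lambda>p. - \<phi> p) p = - grad_x \<phi> p" "Dt (\<lambda>p. - \<phi> p) p = - Dt \<phi> p"
    "mcf_op \<eta> (\<lambda>p. - \<phi> p) p = - mcf_op \<eta> \<phi> p" "mcf_op (- \<eta>) \<phi> p = mcf_op \<eta> \<phi> p" for p \<eta>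
    by (simp_all add: grad_x_def D1 D2 vec_eq_iff Dt_def dirD_minus[OF \<phi>] mcf_op_def sum_negf)
  have *: "(grad_x (\<lambda>p. - \<phi> p) (x0, t0) \<noteq> 0 \<longrightarrow>
          Dt (\<lambda>p. - \<phi> p) (x0, t0) \<ge> mcf_op (grad_x (\<lambda>p. - \<phi> p) (x0, t0)
            /\<^sub>R norm (grad_x (\<lambda>p. - \<phi> p) (x0, t0))) (\<lambda>p. - \<phi> p) (x0, t0)) \<and>
       (grad_x (\<lambda>p. - \<phi> p) (x0, t0) = 0 \<longrightarrow>
          (\<exists>\<eta>. norm \<eta> \<le> 1 \<and> Dt (\<lambda>p. - \<phi> p) (x0, t0) \<ge> mcf_op \<eta> (\<lambda>p. - \<phi> p) (x0, t0)))"
    using assms smooth_minus[OF \<phi>] \<open>t0 > 0\<close> min unfolding mcf_visc_super_def by blast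
  show "Dt \<phi> (x0, t0) \<le> mcf_op (grad_x \<phi> (x0, t0) /\<^sub>R norm (grad_x \<phi> (x0, t0))) \<phi> (x0, t0)"
    if "grad_x \<phi> (x0, t0) \<noteq> 0"
    using * that by (simp add: eq)
  show "\<exists>\<eta>. norm \<eta> \<le> 1 \<and> Dt \<phi> (x0, t0) \<le> mcf_op \<eta> \<phi> (x0, t0)" if "grad_x \<phi> (x0, t0) = 0"
    using * that by (simp add: eq)
qed

lemma modulus_antimono:
  fixes u :: "real^'n::finite \<Rightarrow> real \<Rightarrow> real"
  assumes sol: "mcf_visc_sol u"
    and S: "S > 0" "\<And>x. norm x \<ge> S \<Longrightarrow> u x 0 = c"
    and s: "s \<ge> 0" and t12: "0 \<le> t1" "t1 < t2"
  shows "modulus u s t2 \<le> modulus u s t1"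
proof -
  let ?v = "\<lambda>x t. - u x t"
  have subu: "mcf_visc_sub u" and subv: "mcf_visc_sub ?v"
    using sol mcf_visc_super_minus by (auto simp: mcf_visc_sol_def)
  obtain K where K: "\<And>x t. t \<ge> 0 \<Longrightarrow> \<bar>u x t\<bar> \<le> K"
    using subu unfolding mcf_visc_sub_def cont_bdd_def bounded_iff by force
  have far: "\<exists>R. \<forall>x t. norm x \<ge> R \<longrightarrow> 0 \<le> t \<longrightarrow> t \<le> T \<longrightarrow> \<bar>u x t - c\<bar> \<le> e" if Te: "T \<ge> 0" "e > 0" for T e
  proof -
    obtain R1 where R1: "\<And>x t. norm x \<ge> R1 \<Longrightarrow> 0 \<le> t \<Longrightarrow> t \<le> T \<Longrightarrow> u x t \<le> c + e"
      using spatial_decay[OF subu K S(1) _ Te, of c] S(2) by auto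
    obtain R2 where R2: "\<And>x t. norm x \<ge> R2 \<Longrightarrow> 0 \<le> t \<Longrightarrow> t \<le> T \<Longrightarrow> - u x t \<le> - c + e"
      using spatial_decay[OF subv _ S(1) _ Te, of K "- c"] K S(2) by (auto, blast)
    show ?thesis
      using R1 R2 by (intro exI[of _ "max R1 R2"]) (fastforce simp: abs_le_iff)
  qed
  have bdd: "bdd_above {(u y t - u x t) / 2 | x y. norm (y - x) / 2 = s}" if "t \<ge> 0" for t
  proof (rule bdd_aboveI[of _ K])
    fix r assume "r \<in> {(u y t - u x t) / 2 | x y. norm (y - x) / 2 = s}"
    then obtain x y where "r = (u y t - u x t) / 2" by blast
    then show "r \<le> K" using K[OF that, of x] K[OF that, of y] by (auto simp: abs_le_iff)
  qed
  have upper: "u y t - u x t \<le> 2 * modulus u s t" if "t \<ge> 0" "norm (y - x) / 2 = s" for x y t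
  proof -
    have "(u y t - u x t) / 2 \<le> modulus u s t"
      unfolding modulus_def by (rule cSup_upper[OF _ bdd[OF that(1)]]) (use that in blast)
    then show ?thesis by simp
  qed
  \<comment> \<open>A vector of length \<open>2 * s\<close> shows that the modulus is nonnegative:
    the two orders of a pair of points give opposite differences. \<open>comparison\<close> requires
    this sign.\<close>
  obtain i :: 'n where True by simp
  define w :: "real^'n" where "w = (2 * s) *\<^sub>R axis i 1"
  have w: "norm (w - 0) / 2 = s" using s by (simp add: w_def)
  have nonneg: "modulus u s t1 \<ge> 0"
    using upper[OF t12(1), of w 0] upper[OF t12(1), of 0 w] w by (simp add: norm_minus_commute)
  show ?thesis
    unfolding modulus_def[of u s t2]
  proof (rule cSup_least)
    show "{(u y t2 - u x t2) / 2 | x y. norm (y - x) / 2 = s} \<noteq> {}" using w by blast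
    fix r assume "r \<in> {(u y t2 - u x t2) / 2 | x y. norm (y - x) / 2 = s}"
    then obtain x y where r: "r = (u y t2 - u x t2) / 2" and xy: "norm (y - x) / 2 = s" by blast
    have "u (x + (y - x)) t2 + ?v x t2 \<le> 2 * modulus u s t1"
    proof (rule comparison[OF subu subv K _ far _ _ t12])
      show "\<bar>- u x t\<bar> \<le> K" if "t \<ge> 0" for x t using K[OF that] by simp
      show "\<exists>R. \<forall>x t. norm x \<ge> R \<longrightarrow> 0 \<le> t \<longrightarrow> t \<le> T \<longrightarrow> \<bar>- u x t + c\<bar> \<le> e" if "T \<ge> 0" "e > 0" for T e
        using far[OF that] by (simp add: abs_minus_commute)
      show "u (x' + (y - x)) t1 + - u x' t1 \<le> 2 * modulus u s t1" for x'
        using upper[OF t12(1), of "x' + (y - x)" x'] xy by simp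
    qed (use nonneg in auto)
    then show "r \<le> modulus u s t1" by (simp add: r)
  qed
qed

theorem theorem1p2:
  fixes u :: "real^'n::finite \<Rightarrow> real \<Rightarrow> real" and g :: "real^'n \<Rightarrow> real"
  assumes sol: "mcf_visc_sol u"
    and init: "\<forall>x. u x 0 = g x"
    and gcont: "continuous_on UNIV g"
    and gconst: "\<exists>S>0. \<exists>c. \<forall>x. norm x \<ge> S \<longrightarrow> g x = c"
  shows "\<forall>\<phi> :: real \<times> real \<Rightarrow> real. \<forall>s0 t0.
           smooth \<phi> \<and> s0 > 0 \<and> t0 > 0 \<and>
           (\<exists>e>0. \<forall>s t. s > 0 \<longrightarrow> t > 0 \<longrightarrow> dist (s,t) (s0,t0) < e \<longrightarrow>
               modulus u s t - \<phi> (s,t) \<le> modulus u s0 t0 - \<phi> (s0,t0))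
           \<longrightarrow> Dt \<phi> (s0,t0) \<le>
               max 0 ((dirD (1,0) (dirD (1,0) \<phi>) (s0,t0) + \<bar>dirD (1,0) (dirD (1,0) \<phi>) (s0,t0)\<bar>) / 4)"
proof (intro allI impI, elim conjE exE)
  fix \<phi> :: "real \<times> real \<Rightarrow> real" and s0 t0 e :: real
  assume \<phi>: "smooth \<phi>" and s0: "s0 > 0" and t0: "t0 > 0" and e: "e > 0"
    and max: "\<forall>s t. s > 0 \<longrightarrow> t > 0 \<longrightarrow> dist (s,t) (s0,t0) < e \<longrightarrow>
               modulus u s t - \<phi> (s,t) \<le> modulus u s0 t0 - \<phi> (s0,t0)"
  obtain S c where S: "S > 0" "\<And>x. norm x \<ge> S \<Longrightarrow> u x 0 = c" using gconst init by auto
  have "Dt (\<lambda>p. - \<phi> p) (s0, t0) \<ge> 0"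
  \<comment> \<open>The time window stays inside the neighbourhood of radius \<open>e\<close> and at
    positive times. In it the modulus is no smaller than at \<open>t0\<close>, so touching forces
    the same for \<open>\<phi>\<close>.\<close>
  proof (rule Dt_nonneg_of_left_max[OF smooth_minus[OF \<phi>], of "t0 - min (e / 2) (t0 / 2)"])
    show "t0 - min (e / 2) (t0 / 2) < t0" using e t0 by simp
    fix t assume t: "t0 - min (e / 2) (t0 / 2) \<le> t" "t \<le> t0"
    show "- \<phi> (s0, t) \<le> - \<phi> (s0, t0)"
    proof (cases "t = t0")
      case False
      then have tt: "0 < t" "t < t0" "\<bar>t - t0\<bar> < e" using t t0 e by (auto simp: min_def split: if_splits)
      then have "dist (s0, t) (s0, t0) < e" by (simp add: dist_Pair_Pair dist_real_def)
      then have "modulus u s0 t - \<phi> (s0, t) \<le> modulus u s0 t0 - \<phi> (s0, t0)" using max s0 tt by blast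
      moreover have "modulus u s0 t0 \<le> modulus u s0 t"
        using modulus_antimono[OF sol S] s0 tt by simp
      ultimately show ?thesis by simp
    qed simp
  qed
  then have "Dt \<phi> (s0, t0) \<le> 0" by (simp add: Dt_def dirD_minus[OF \<phi>])
  then show "Dt \<phi> (s0,t0) \<le>
      max 0 ((dirD (1,0) (dirD (1,0) \<phi>) (s0,t0) + \<bar>dirD (1,0) (dirD (1,0) \<phi>) (s0,t0)\<bar>) / 4)"
    by simp
qed

end
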